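(* Let $X_{\mathsf{KW}}$ be the Kadets--Werner space, a nonzero closed linear subspace of $L_1=L_1([0,1])$ with the norm $\|\cdot\|_1$, which has the Daugavet Property and whose closed unit ball is relatively compact with respect to the topology of convergence in measure. Then $X_{\mathsf{KW}}$ is asymptotically midpoint uniformly convex, $X_{\mathsf{KW}}$ fails the Point of Continuity Property, and $X_{\mathsf{KW}}$ does not admit an equivalent norm that is asymptotically uniformly convex.
   Context: Scalars are real. $L_1=L_1([0,1])$ is the Banach space of (classes of) Lebesgue integrable functions on $[0,1]$ with the norm $\|f\|_1=\int_0^1|f|$. The topology of convergence in measure is the usual (metrizable) topology on the space $L_0([0,1])$ of all classes of measurable functions: $f_n\to f$ in measure iff $\lambda(\{|f_n-f|\ge\eta\})\to 0$ for every $\eta>0$, where $\lambda$ is Lebesgue measure. A set is relatively compact for this topology if its closure in $L_0([0,1])$ is compact. The space $X_{\mathsf{KW}}$ is the (separable) closed subspace of $L_1$ constructed by Kadets and Werner ("A Banach space with the Schur and the Daugavet property") as a modification of a subspace of $L_1$ constructed by Bourgain and Rosenthal, namely as the closure of the union of a suitable increasing sequence of finite-dimensional subspaces of $L_1$. The properties of it known from earlier work and relevant here are the two listed in the claim: the Daugavet Property, and relative compactness of its unit ball for convergence in measure. No other feature of the construction is needed to interpret the claim. Definitions, for a Banach space $(X,\|\cdot\|_X)$, with closed unit ball $B_X$, unit sphere $S_X$, and $\mathrm{cof}(X)$ the set of closed finite-codimensional linear subspaces of $X$: - Daugavet Property: $\|\mathrm{Id}+T\|=\|\mathrm{Id}\|+\|T\|$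 for every bounded rank one operator $T:X\to X$. - Asymptotically uniformly convex: $\overline\delta_X(t)>0$ for every $t>0$, where $$\overline\delta_X(t)=\inf_{x\in S_X}\ \sup_{Z\in\mathrm{cof}(X)}\ \inf_{z\in S_Z}\bigl(\|x+tz\|_X-1\bigr).$$ - Asymptotically midpoint uniformly convex: $\tilde\delta_X(t)>0$ for every $t>0$, where $$\tilde\delta_X(t)=\inf_{x\in S_X}\ \sup_{Z\in\mathrm{cof}(X)}\ \inf_{z\in S_Z}\bigl(\max\{\|x+tz\|_X,\|x-tz\|_X\}-1\bigr).$$ (The infimum over an empty set is $+\infty$. Both are properties of the given norm.) - Point of Continuity Property: for every nonempty bounded closed subset $C$ of $X$, the identity map from $C$ with the relative weak topology to $C$ with the relative norm topology has a point of continuity. - An equivalent norm on $X$ is a norm $|\cdot|$ on $X$ for which there are constants $a,b>0$ with $a\|x\|_X\le|x|\le b\|x\|_X$ for all $x\in X$. *)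

theory Defs
  imports "HOL-Analysis.Analysis"
begin

section \<open>The space \<open>L\<^sub>0([0,1])\<close> and its subspace \<open>L\<^sub>1([0,1])\<close>\<close>

abbreviation unit_interval :: "real measure" where
  "unit_interval \<equiv> lebesgue_on {0..1}"

quotient_type l0 = "real \<Rightarrow> real" / partial:
  "\<lambda>f g. f \<in> borel_measurable unit_interval \<and> g \<in> borel_measurable unit_interval \<and>
         (AE x in unit_interval. f x = g x)"
proof (rule part_equivpI)
  show "\<exists>f :: real \<Rightarrow> real. f \<in> borel_measurable unit_interval \<and>
      f \<in> borel_measurable unit_interval \<and> (AE x in unit_interval. f x = f x)"
    by (rule exI[of _ "\<lambda>_. 0"]) simp
  show "symp (\<lambda>f g. f \<in> borel_measurable unit_interval \<and> g \<in> borel_measurable unit_interval \<and>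
         (AE x in unit_interval. (f x :: real) = g x))"
    by (auto simp: symp_def eq_commute)
  show "transp (\<lambda>f g. f \<in> borel_measurable unit_interval \<and> g \<in> borel_measurable unit_interval \<and>
         (AE x in unit_interval. (f x :: real) = g x))"
    by (rule transpI) auto
qed

instantiation l0 :: real_vector
begin

lift_definition zero_l0 :: l0 is "\<lambda>_. 0" by simp
lift_definition plus_l0 :: "l0 \<Rightarrow> l0 \<Rightarrow> l0" is "\<lambda>f g x. f x + g x" by auto
lift_definition uminus_l0 :: "l0 \<Rightarrow> l0" is "\<lambda>f x. - f x" by auto
lift_definition minus_l0 :: "l0 \<Rightarrow> l0 \<Rightarrow> l0" is "\<lambda>f g x. f x - g x" by auto
lift_definition scaleR_l0 :: "real \<Rightarrow> l0 \<Rightarrow> l0" is "\<lambda>c f x. c * f x" by auto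

instance
  by standard (transfer; auto simp: algebra_simps)+

end

lift_definition integrable_l0 :: "l0 \<Rightarrow> bool" is "integrable unit_interval"
  using integrable_cong_AE by blast

lift_definition norm1 :: "l0 \<Rightarrow> real" is "\<lambda>f. LINT x|unit_interval. \<bar>f x\<bar>"
  by (rule integral_cong_AE) auto

definition L1 :: "l0 set" where
  "L1 = {f. integrable_l0 f}"

section \<open>Convergence in measure\<close>

lemma deviation_set:
  fixes f g :: "real \<Rightarrow> real"
  assumes [measurable]: "f \<in> borel_measurable unit_interval" "g \<in> borel_measurable unit_interval"
  shows "{x \<in> space unit_interval. \<eta> \<le> \<bar>f x - g x\<bar>} \<in> sets unit_interval"
  by measurable

lift_definition deviation :: "real \<Rightarrow> l0 \<Rightarrow> l0 \<Rightarrow> real" is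
  "\<lambda>\<eta> f g. measure unit_interval {x \<in> {0..1}. \<bar>f x - g x\<bar> \<ge> \<eta>}"
proof -
  fix \<eta> :: real and f f' g g' :: "real \<Rightarrow> real"
  assume f: "f \<in> borel_measurable unit_interval \<and> f' \<in> borel_measurable unit_interval \<and>
      (AE x in unit_interval. f x = f' x)"
    and g: "g \<in> borel_measurable unit_interval \<and> g' \<in> borel_measurable unit_interval \<and>
      (AE x in unit_interval. g x = g' x)"
  show "measure unit_interval {x \<in> {0..1}. \<bar>f x - g x\<bar> \<ge> \<eta>} =
        measure unit_interval {x \<in> {0..1}. \<bar>f' x - g' x\<bar> \<ge> \<eta>}"
    by (rule measure_eq_AE) (use f g deviation_set[of f g \<eta>] deviation_set[of f' g' \<eta>] in auto)
qed

definition measure_topology :: "l0 topology" where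
  "measure_topology = topology (\<lambda>U. \<forall>f\<in>U. \<exists>\<eta>>0. \<exists>\<epsilon>>0. {g. deviation \<eta> g f < \<epsilon>} \<subseteq> U)"

lemma finite_measure_unit_interval: "finite_measure unit_interval"
  by (rule finite_measureI) (simp add: emeasure_restrict_space)

lemma deviation_antimono:
  assumes "\<eta> \<le> \<eta>'"
  shows "deviation \<eta>' f g \<le> deviation \<eta> f g"
proof (transfer fixing: \<eta> \<eta>', goal_cases)
  case (1 f g)
  interpret finite_measure unit_interval by (rule finite_measure_unit_interval)
  have "{x \<in> space unit_interval. \<eta> \<le> \<bar>f x - g x\<bar>} \<in> sets unit_interval"
    using 1 by (intro deviation_set) auto
  then show ?case
    using assms by (intro finite_measure_mono) auto
qed

lemma openin_measure_topology:
  "openin measure_topology U \<longleftrightarrow> (\<forall>f\<in>U. \<exists>\<eta>>0. \<exists>\<epsilon>>0. {g. deviation \<eta> g f < \<epsilon>} \<subseteq> U)"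
proof -
  have "istopology (\<lambda>U. \<forall>f\<in>U. \<exists>\<eta>>0. \<exists>\<epsilon>>0. {g. deviation \<eta> g f < \<epsilon>} \<subseteq> U)"
    unfolding istopology_def
  proof (intro conjI allI impI ballI)
    fix S T f
    assume S: "\<forall>f\<in>S. \<exists>\<eta>>0. \<exists>\<epsilon>>0. {g. deviation \<eta> g f < \<epsilon>} \<subseteq> S"
      and T: "\<forall>f\<in>T. \<exists>\<eta>>0. \<exists>\<epsilon>>0. {g. deviation \<eta> g f < \<epsilon>} \<subseteq> T" and f: "f \<in> S \<inter> T"
    obtain a b where 1: "a > 0" "b > 0" "{g. deviation a g f < b} \<subseteq> S" using S f by blast
    obtain c d where 2: "c > 0" "d > 0" "{g. deviation c g f < d} \<subseteq> T" using T f by blast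
    have "{g. deviation (min a c) g f < min b d} \<subseteq> S \<inter> T"
      using 1(3) 2(3) deviation_antimono[of "min a c" a _ f] deviation_antimono[of "min a c" c _ f]
      by (fastforce intro: le_less_trans)
    moreover have "min a c > 0" "min b d > 0"
      using 1 2 by auto
    ultimately show "\<exists>\<eta>>0. \<exists>\<epsilon>>0. {g. deviation \<eta> g f < \<epsilon>} \<subseteq> S \<inter> T" by blast
  next
    fix K f
    assume "\<forall>S\<in>K. \<forall>f\<in>S. \<exists>\<eta>>0. \<exists>\<epsilon>>0. {g. deviation \<eta> g f < \<epsilon>} \<subseteq> S" "f \<in> \<Union>K"
    then show "\<exists>\<eta>>0. \<exists>\<epsilon>>0. {g. deviation \<eta> g f < \<epsilon>} \<subseteq> \<Union>K"
      by (meson UnionE Union_upper order_trans)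
  qed
  then show ?thesis by (simp add: measure_topology_def)
qed

lemma topspace_measure_topology [simp]: "topspace measure_topology = UNIV"
proof -
  have "openin measure_topology UNIV"
    unfolding openin_measure_topology using zero_less_one by blast
  then show ?thesis
    using openin_subset by blast
qed

lift_definition dist_l0 :: "l0 \<Rightarrow> l0 \<Rightarrow> real" is
  "\<lambda>f g. LINT x|unit_interval. min 1 \<bar>f x - g x\<bar>"
  by (rule integral_cong_AE) auto

lemma integrable_min_1:
  fixes f g :: "real \<Rightarrow> real"
  assumes "f \<in> borel_measurable unit_interval" "g \<in> borel_measurable unit_interval"
  shows "integrable unit_interval (\<lambda>x. min 1 \<bar>f x - g x\<bar>)"
proof -
  interpret finite_measure unit_interval by (rule finite_measure_unit_interval)
  show ?thesis
    by (rule integrable_const_bound[where B = 1]) (use assms in auto)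
qed

lemma Metric_space_dist_l0: "Metric_space UNIV dist_l0"
proof
  show "0 \<le> dist_l0 f g" for f g
    by transfer (auto intro!: integral_nonneg_AE)
  show "dist_l0 f g = dist_l0 g f" for f g
    by transfer (simp add: abs_minus_commute)
  show "dist_l0 f g = 0 \<longleftrightarrow> f = g" for f g
  proof (transfer, goal_cases)
    case (1 f g)
    have "(LINT x|unit_interval. min 1 \<bar>f x - g x\<bar>) = 0 \<longleftrightarrow>
          (AE x in unit_interval. min 1 \<bar>f x - g x\<bar> = 0)"
      using 1 by (intro integral_nonneg_eq_0_iff_AE integrable_min_1) auto
    also have "\<dots> \<longleftrightarrow> (AE x in unit_interval. f x = g x)"
      by (intro arg_cong2[where f = almost_everywhere] refl ext iffI) (auto simp: min_def split: if_splits)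
    finally show ?case using 1 by simp
  qed
  show "dist_l0 f h \<le> dist_l0 f g + dist_l0 g h" for f g h
  proof (transfer, goal_cases)
    case (1 f h g)
    have "(LINT x|unit_interval. min 1 \<bar>f x - h x\<bar>)
        \<le> (LINT x|unit_interval. min 1 \<bar>f x - g x\<bar> + min 1 \<bar>g x - h x\<bar>)"
      using 1 by (intro integral_mono Bochner_Integration.integrable_add integrable_min_1) auto
    then show ?case
      using 1 by (simp add: integrable_min_1)
  qed
qed

lemma dist_l0_le_deviation:
  assumes "\<eta> > 0"
  shows "dist_l0 f g \<le> \<eta> + deviation \<eta> f g"
proof (transfer fixing: \<eta>, goal_cases)
  case (1 f g)
  interpret finite_measure unit_interval by (rule finite_measure_unit_interval)
  define A where "A = {x \<in> space unit_interval. \<eta> \<le> \<bar>f x - g x\<bar>}"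
  have A: "A \<in> sets unit_interval"
    unfolding A_def using 1 by (intro deviation_set) auto
  have ind: "integrable unit_interval (indicat_real A)"
    using A by (simp add: emeasure_eq_measure)
  have "(LINT x|unit_interval. min 1 \<bar>f x - g x\<bar>) \<le> (LINT x|unit_interval. \<eta> + indicat_real A x)"
  proof (rule integral_mono)
    show "integrable unit_interval (\<lambda>x. \<eta> + indicat_real A x)"
      using ind by simp
  qed (use 1 assms in \<open>auto simp: A_def indicator_def integrable_min_1\<close>)
  also have "\<dots> = \<eta> + measure unit_interval A"
    using ind A sets.sets_into_space[OF A]
    by (simp add: measure_restrict_space Int_absorb2)
  finally show ?case by (simp add: A_def)
qed

lemma deviation_le_dist_l0:
  assumes "\<eta> > 0"
  shows "min 1 \<eta> * deviation \<eta> f g \<le> dist_l0 f g"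
proof (transfer fixing: \<eta>, goal_cases)
  case (1 f g)
  interpret finite_measure unit_interval by (rule finite_measure_unit_interval)
  define A where "A = {x \<in> space unit_interval. \<eta> \<le> \<bar>f x - g x\<bar>}"
  have A: "A \<in> sets unit_interval"
    unfolding A_def using 1 by (intro deviation_set) auto
  have ind: "integrable unit_interval (indicat_real A)"
    using A by (simp add: emeasure_eq_measure)
  have "(LINT x|unit_interval. min 1 \<eta> * indicat_real A x) \<le> (LINT x|unit_interval. min 1 \<bar>f x - g x\<bar>)"
  proof (rule integral_mono)
    show "integrable unit_interval (\<lambda>x. min 1 \<eta> * indicat_real A x)"
      using ind by simp
  qed (use 1 assms in \<open>auto simp: A_def indicator_def integrable_min_1\<close>)
  then show ?case
    using ind A sets.sets_into_space[OF A] by (simp add: A_def Int_absorb2)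
qed

lemma measure_topology_eq_mtopology:
  "measure_topology = Metric_space.mtopology UNIV dist_l0"
proof -
  interpret Metric_space UNIV dist_l0 by (rule Metric_space_dist_l0)
  show ?thesis
    unfolding topology_eq openin_measure_topology openin_mtopology
  proof (intro allI iffI)
    fix U
    assume U: "\<forall>f\<in>U. \<exists>\<eta>>0. \<exists>\<epsilon>>0. {g. deviation \<eta> g f < \<epsilon>} \<subseteq> U"
    show "U \<subseteq> UNIV \<and> (\<forall>f. f \<in> U \<longrightarrow> (\<exists>r>0. mball f r \<subseteq> U))"
    proof (intro conjI allI impI)
      fix f assume "f \<in> U"
      then obtain \<eta> \<epsilon> where *: "\<eta> > 0" "\<epsilon> > 0" "{g. deviation \<eta> g f < \<epsilon>} \<subseteq> U"
        using U by blast
      have "deviation \<eta> g f < \<epsilon>" if "dist_l0 f g < min 1 \<eta> * \<epsilon>" for g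
      proof -
        have "min 1 \<eta> * deviation \<eta> g f < min 1 \<eta> * \<epsilon>"
          using deviation_le_dist_l0[OF *(1), of g f] that by (simp add: commute)
        then show ?thesis using *(1) by (simp add: mult_less_cancel_left)
      qed
      then have "mball f (min 1 \<eta> * \<epsilon>) \<subseteq> U"
        using *(3) by auto
      then show "\<exists>r>0. mball f r \<subseteq> U"
        using * by (intro exI[of _ "min 1 \<eta> * \<epsilon>"]) auto
    qed auto
  next
    fix U
    assume U: "U \<subseteq> UNIV \<and> (\<forall>f. f \<in> U \<longrightarrow> (\<exists>r>0. mball f r \<subseteq> U))"
    show "\<forall>f\<in>U. \<exists>\<eta>>0. \<exists>\<epsilon>>0. {g. deviation \<eta> g f < \<epsilon>} \<subseteq> U"
    proof
      fix f assume "f \<in> U"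
      then obtain r where r: "r > 0" "mball f r \<subseteq> U" using U by blast
      have "{g. deviation (r/2) g f < r/2} \<subseteq> U"
      proof clarify
        fix g assume "deviation (r/2) g f < r/2"
        then have "dist_l0 f g < r"
          using dist_l0_le_deviation[of "r/2" g f] r(1) by (simp add: commute)
        then show "g \<in> U" using r(2) by auto
      qed
      then show "\<exists>\<eta>>0. \<exists>\<epsilon>>0. {g. deviation \<eta> g f < \<epsilon>} \<subseteq> U"
        using r(1) half_gt_zero by blast
    qed
  qed
qed

lemma limitin_measure_topology:
  "limitin measure_topology F f sequentially \<longleftrightarrow>
     (\<forall>\<eta>>0. (\<lambda>n. deviation \<eta> (F n) f) \<longlonglongrightarrow> 0)"
proof -
  interpret Metric_space UNIV dist_l0 by (rule Metric_space_dist_l0)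
  have dev0: "deviation \<eta> g h \<ge> 0" for \<eta> g h
    by transfer simp
  have lim: "limitin measure_topology F f sequentially \<longleftrightarrow> (\<lambda>n. dist_l0 (F n) f) \<longlonglongrightarrow> 0"
    by (simp add: measure_topology_eq_mtopology limitin_metric_dist_null)
  show ?thesis
    unfolding lim
  proof (intro iffI allI impI)
    fix \<eta> :: real
    assume *: "(\<lambda>n. dist_l0 (F n) f) \<longlonglongrightarrow> 0" and "\<eta> > 0"
    have "deviation \<eta> (F n) f \<le> dist_l0 (F n) f / min 1 \<eta>" for n
      using deviation_le_dist_l0[OF \<open>\<eta> > 0\<close>, of "F n" f] \<open>\<eta> > 0\<close>
      by (simp add: pos_le_divide_eq mult.commute)
    moreover have "(\<lambda>n. dist_l0 (F n) f / min 1 \<eta>) \<longlonglongrightarrow> 0"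
      using tendsto_divide_zero[OF *] by blast
    ultimately show "(\<lambda>n. deviation \<eta> (F n) f) \<longlonglongrightarrow> 0"
      using tendsto_sandwich[of "\<lambda>_. 0" "\<lambda>n. deviation \<eta> (F n) f" sequentially
          "\<lambda>n. dist_l0 (F n) f / min 1 \<eta>" 0] dev0 by simp
  next
    assume *: "\<forall>\<eta>>0. (\<lambda>n. deviation \<eta> (F n) f) \<longlonglongrightarrow> 0"
    show "(\<lambda>n. dist_l0 (F n) f) \<longlonglongrightarrow> 0"
    proof (rule order_tendstoI)
      show "\<forall>\<^sub>F n in sequentially. a < dist_l0 (F n) f" if "a < 0" for a
        using that nonneg by (auto intro!: always_eventually intro: less_le_trans)
      fix r :: real assume "r > 0"
      then have "\<forall>\<^sub>F n in sequentially. deviation (r/2) (F n) f < r/2"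
        using * by (intro order_tendstoD(2)[where y = 0]) auto
      then show "\<forall>\<^sub>F n in sequentially. dist_l0 (F n) f < r"
      proof eventually_elim
        case (elim n)
        then show ?case
          using dist_l0_le_deviation[of "r/2" "F n" f] \<open>r > 0\<close> by simp
      qed
    qed
  qed
qed

definition relatively_compact_in :: "'a topology \<Rightarrow> 'a set \<Rightarrow> bool" where
  "relatively_compact_in T S \<longleftrightarrow> compactin T (T closure_of S)"

section \<open>Normed spaces on a carrier\<close>

text \<open>Below, a normed space is a pair of a linear subspace \<open>X\<close> of an ambient real vector space and a
  function \<open>N\<close> of which only the values on \<open>X\<close> matter.\<close>

definition is_norm_on :: "'a::real_vector set \<Rightarrow> ('a \<Rightarrow> real) \<Rightarrow> bool" where
  "is_norm_on X N \<longleftrightarrow>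
     (\<forall>x\<in>X. N x = 0 \<longleftrightarrow> x = 0) \<and>
     (\<forall>x\<in>X. \<forall>c. N (c *\<^sub>R x) = \<bar>c\<bar> * N x) \<and>
     (\<forall>x\<in>X. \<forall>y\<in>X. N (x + y) \<le> N x + N y)"

definition equivalent_norm :: "'a::real_vector set \<Rightarrow> ('a \<Rightarrow> real) \<Rightarrow> ('a \<Rightarrow> real) \<Rightarrow> bool" where
  "equivalent_norm X N N' \<longleftrightarrow>
     is_norm_on X N' \<and> (\<exists>a>0. \<exists>b>0. \<forall>x\<in>X. a * N x \<le> N' x \<and> N' x \<le> b * N x)"

text \<open>The value \<open>0\<close> outside \<open>X\<close> only serves the axioms of \<^locale>\<open>Metric_space\<close>, which require
  nonnegativity and symmetry on the whole type.\<close>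

definition norm_topology :: "'a::real_vector set \<Rightarrow> ('a \<Rightarrow> real) \<Rightarrow> 'a topology" where
  "norm_topology X N =
     Metric_space.mtopology X (\<lambda>x y. if x \<in> X \<and> y \<in> X then N (x - y) else 0)"

definition unit_ball :: "'a::real_vector set \<Rightarrow> ('a \<Rightarrow> real) \<Rightarrow> 'a set" where
  "unit_ball X N = {x \<in> X. N x \<le> 1}"

definition unit_sphere :: "'a::real_vector set \<Rightarrow> ('a \<Rightarrow> real) \<Rightarrow> 'a set" where
  "unit_sphere X N = {x \<in> X. N x = 1}"

definition is_linear_on :: "'a::real_vector set \<Rightarrow> ('a \<Rightarrow> 'b::real_vector) \<Rightarrow> bool" where
  "is_linear_on X f \<longleftrightarrow>
     (\<forall>x\<in>X. \<forall>y\<in>X. f (x + y) = f x + f y) \<and> (\<forall>x\<in>X. \<forall>c. f (c *\<^sub>R x) = c *\<^sub>R f x)"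

lemma is_norm_on_nonneg:
  assumes "subspace X" "is_norm_on X N" "x \<in> X"
  shows "N x \<ge> 0"
proof -
  have "N 0 = 0"
    using assms subspace_0 by (auto simp: is_norm_on_def)
  moreover have "N (- x) = N x"
  proof -
    have "N ((-1) *\<^sub>R x) = \<bar>-1\<bar> * N x"
      using assms(2,3) unfolding is_norm_on_def by blast
    then show ?thesis by simp
  qed
  moreover have "N (x + - x) \<le> N x + N (- x)"
    using assms subspace_neg[OF assms(1,3)] unfolding is_norm_on_def by blast
  ultimately show ?thesis by simp
qed

lemma Metric_space_norm:
  assumes "subspace X" "is_norm_on X N"
  shows "Metric_space X (\<lambda>x y. if x \<in> X \<and> y \<in> X then N (x - y) else 0)"
proof
  have diff: "x - y \<in> X" if "x \<in> X" "y \<in> X" for x y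
    using assms that subspace_diff by blast
  show "0 \<le> (if x \<in> X \<and> y \<in> X then N (x - y) else 0)" for x y
    using is_norm_on_nonneg[OF assms] diff by auto
  have "N (x - y) = N (y - x)" if "x \<in> X" "y \<in> X" for x y
  proof -
    have "N ((-1) *\<^sub>R (y - x)) = \<bar>-1\<bar> * N (y - x)"
      using assms(2) diff[OF that(2,1)] unfolding is_norm_on_def by blast
    then show ?thesis by simp
  qed
  then show "(if x \<in> X \<and> y \<in> X then N (x - y) else 0) =
             (if y \<in> X \<and> x \<in> X then N (y - x) else 0)" for x y
    by auto
  show "(if x \<in> X \<and> y \<in> X then N (x - y) else 0) = 0 \<longleftrightarrow> x = y" if "x \<in> X" "y \<in> X" for x y
    using assms(2) diff[OF that] that by (simp add: is_norm_on_def)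
  show "(if x \<in> X \<and> z \<in> X then N (x - z) else 0) \<le>
        (if x \<in> X \<and> y \<in> X then N (x - y) else 0) + (if y \<in> X \<and> z \<in> X then N (y - z) else 0)"
    if "x \<in> X" "y \<in> X" "z \<in> X" for x y z
  proof -
    have "N ((x - y) + (y - z)) \<le> N (x - y) + N (y - z)"
      using assms(2) diff[OF that(1,2)] diff[OF that(2,3)] unfolding is_norm_on_def by blast
    then show ?thesis using that by simp
  qed
qed

lemma subspace_L1: "subspace L1"
proof (rule subspaceI)
  show "0 \<in> L1"
    unfolding L1_def mem_Collect_eq by transfer simp
  show "f + g \<in> L1" if "f \<in> L1" "g \<in> L1" for f g
    using that unfolding L1_def mem_Collect_eq by transfer simp
  show "c *\<^sub>R f \<in> L1" if "f \<in> L1" for c f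
    using that unfolding L1_def mem_Collect_eq by transfer simp
qed

lemma is_norm_on_L1: "is_norm_on L1 norm1"
  unfolding is_norm_on_def
proof (intro conjI ballI allI)
  fix f assume f: "f \<in> L1"
  then show "norm1 f = 0 \<longleftrightarrow> f = 0"
    unfolding L1_def mem_Collect_eq
  proof (transfer, goal_cases)
    case (1 f)
    then show ?case
      by (subst integral_nonneg_eq_0_iff_AE) auto
  qed
  show "norm1 (c *\<^sub>R f) = \<bar>c\<bar> * norm1 f" for c
    by transfer (simp add: abs_mult)
  fix g assume g: "g \<in> L1"
  show "norm1 (f + g) \<le> norm1 f + norm1 g"
    using f g unfolding L1_def mem_Collect_eq
  proof (transfer, goal_cases)
    case (1 f g)
    then have "(LINT x|unit_interval. \<bar>f x + g x\<bar>) \<le> (LINT x|unit_interval. \<bar>f x\<bar> + \<bar>g x\<bar>)"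
      by (intro integral_mono) auto
    then show ?case using 1 by simp
  qed
qed

section \<open>The Daugavet Property\<close>

definition bounded_operator :: "'a::real_vector set \<Rightarrow> ('a \<Rightarrow> real) \<Rightarrow> ('a \<Rightarrow> 'a) \<Rightarrow> bool" where
  "bounded_operator X N T \<longleftrightarrow>
     T ` X \<subseteq> X \<and> is_linear_on X T \<and> (\<exists>B. \<forall>x\<in>X. N (T x) \<le> B * N x)"

definition op_norm :: "'a::real_vector set \<Rightarrow> ('a \<Rightarrow> real) \<Rightarrow> ('a \<Rightarrow> 'a) \<Rightarrow> real" where
  "op_norm X N T = (SUP x\<in>unit_ball X N. N (T x))"

definition daugavet_property :: "'a::real_vector set \<Rightarrow> ('a \<Rightarrow> real) \<Rightarrow> bool" where
  "daugavet_property X N \<longleftrightarrow>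
     (\<forall>T. bounded_operator X N T \<and> dim (T ` X) = 1 \<longrightarrow>
        op_norm X N (\<lambda>x. x + T x) = op_norm X N (\<lambda>x. x) + op_norm X N T)"

section \<open>Asymptotic convexity\<close>

definition cof :: "'a::real_vector set \<Rightarrow> ('a \<Rightarrow> real) \<Rightarrow> 'a set set" where
  "cof X N = {Z. subspace Z \<and> Z \<subseteq> X \<and> closedin (norm_topology X N) Z \<and>
                 (\<exists>F. finite F \<and> span (Z \<union> F) = X)}"

text \<open>The moduli are extended reals, so that the infimum over an empty sphere is \<open>\<infinity>\<close>.\<close>

definition auc_modulus :: "'a::real_vector set \<Rightarrow> ('a \<Rightarrow> real) \<Rightarrow> real \<Rightarrow> ereal" where
  "auc_modulus X N t =
     (INF x\<in>unit_sphere X N. SUP Z\<in>cof X N. INF z\<in>unit_sphere Z N.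
        ereal (N (x + t *\<^sub>R z) - 1))"

definition amuc_modulus :: "'a::real_vector set \<Rightarrow> ('a \<Rightarrow> real) \<Rightarrow> real \<Rightarrow> ereal" where
  "amuc_modulus X N t =
     (INF x\<in>unit_sphere X N. SUP Z\<in>cof X N. INF z\<in>unit_sphere Z N.
        ereal (max (N (x + t *\<^sub>R z)) (N (x - t *\<^sub>R z)) - 1))"

definition asymp_uniformly_convex :: "'a::real_vector set \<Rightarrow> ('a \<Rightarrow> real) \<Rightarrow> bool" where
  "asymp_uniformly_convex X N \<longleftrightarrow> (\<forall>t>0. auc_modulus X N t > 0)"

definition asymp_midpoint_uniformly_convex :: "'a::real_vector set \<Rightarrow> ('a \<Rightarrow> real) \<Rightarrow> bool" where
  "asymp_midpoint_uniformly_convex X N \<longleftrightarrow> (\<forall>t>0. amuc_modulus X N t > 0)"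

section \<open>The Point of Continuity Property\<close>

definition dual_space :: "'a::real_vector set \<Rightarrow> ('a \<Rightarrow> real) \<Rightarrow> ('a \<Rightarrow> real) set" where
  "dual_space X N = {\<phi>. is_linear_on X \<phi> \<and> (\<exists>B. \<forall>x\<in>X. \<bar>\<phi> x\<bar> \<le> B * N x)}"

definition weak_topology :: "'a::real_vector set \<Rightarrow> ('a \<Rightarrow> real) \<Rightarrow> 'a topology" where
  "weak_topology X N =
     topology_generated_by {{x \<in> X. \<phi> x \<in> U} | \<phi> U. \<phi> \<in> dual_space X N \<and> open U}"

definition continuity_point :: "'a topology \<Rightarrow> 'b topology \<Rightarrow> ('a \<Rightarrow> 'b) \<Rightarrow> 'a \<Rightarrow> bool" where
  "continuity_point S T f x \<longleftrightarrow> x \<in> topspace S \<and> limitin T f (f x) (atin S x)"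

definition point_of_continuity_property :: "'a::real_vector set \<Rightarrow> ('a \<Rightarrow> real) \<Rightarrow> bool" where
  "point_of_continuity_property X N \<longleftrightarrow>
     (\<forall>C. C \<subseteq> X \<and> C \<noteq> {} \<and> (\<exists>B. \<forall>x\<in>C. N x \<le> B) \<and> closedin (norm_topology X N) C \<longrightarrow>
        (\<exists>x. continuity_point (subtopology (weak_topology X N) C)
                               (subtopology (norm_topology X N) C) (\<lambda>y. y) x))"

end

theory Submission
  imports Defs
begin

text \<open>
  The ball of a Daugavet space has no small relatively weakly open subsets: every weak neighbourhood
  of a point \<open>x\<close> of the ball contains a point \<open>u\<close> of the ball with \<open>N (u - x)\<close> arbitrarily close
  to \<open>N x + 1\<close> (\<open>daugavet_weak_neighbourhood\<close>). This is Shvydkoy's theorem, and both negative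
  assertions follow from it. To prove it, apply the Daugavet equation to \<open>\<psi>(\<cdot>) y\<close>: every slice of the
  ball contains a \<open>u\<close> for which \<open>N (y + s u)\<close> is almost \<open>N y + s\<close>. For finitely many functionals,
  let \<open>A\<close> be the set of points of the ball near which, as measured by these functionals, such a \<open>u\<close>
  exists for all \<open>y\<close> and \<open>s\<close>. Choosing the points one after the other shows that \<open>A\<close> is convex;
  \<open>A\<close> meets every slice, because every slice contains one on which the given functionals are almost
  constant; and a convex set that meets every slice is weakly dense, by separation. The last two steps
  concern finitely many functionals only, and extremising a quadratic form in them replaces the
  compactness of the bidual ball.

  Hence the identity of the ball is nowhere weak-to-norm continuous, and the Point of Continuity
  Property fails. Suppose moreover that an equivalent norm \<open>N'\<close> is asymptotically uniformly convex.
  Take \<open>x\<close> in the \<open>N\<close>-ball with \<open>N' x\<close> close to its supremum \<open>R\<close> on that ball. All \<open>u\<close> with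
  \<open>u - x\<close> close to a suitable finite-codimensional subspace and far from zero then have
  \<open>N' u > R\<close>; but such \<open>u\<close> exist in the ball, because closeness to a closed
  finite-codimensional subspace is a weak neighbourhood condition.

  For the midpoint convexity of \<open>norm1\<close>, cover the ball by finitely many small balls in measure with
  centres \<open>f\<close>, and restrict to the \<open>z\<close> of norm one with \<open>\<integral> z sgn f = 0\<close> for every centre. Where
  \<open>z\<close> is close to one of the \<open>f\<close>, the sign of \<open>f\<close> is essentially that of \<open>z\<close>; since the pairing
  vanishes, at least about half of the mass of \<open>z\<close> must sit on the small set where \<open>z\<close> is far from
  \<open>f\<close>. That half is almost disjoint from \<open>x\<close>, so the mean of the norms of \<open>x + t z\<close> and
  \<open>x - t z\<close> exceeds the norm of \<open>x\<close> by nearly \<open>t / 2\<close>.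
\<close>

section \<open>Normed spaces on a carrier\<close>

locale normed_subspace =
  fixes X :: "'a::real_vector set" and N :: "'a \<Rightarrow> real"
  assumes subspace_carrier: "subspace X" and is_norm: "is_norm_on X N"
begin

lemma carrier_closed [simp, intro]:
  "0 \<in> X" "x \<in> X \<Longrightarrow> y \<in> X \<Longrightarrow> x + y \<in> X" "x \<in> X \<Longrightarrow> y \<in> X \<Longrightarrow> x - y \<in> X"
  "x \<in> X \<Longrightarrow> c *\<^sub>R x \<in> X" "x \<in> X \<Longrightarrow> - x \<in> X"
  using subspace_carrier
  by (auto simp: subspace_0 subspace_add subspace_diff subspace_scale subspace_neg)

lemma N_nonneg: "x \<in> X \<Longrightarrow> 0 \<le> N x"
  using is_norm_on_nonneg[OF subspace_carrier is_norm] .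

lemma N_eq_0: "x \<in> X \<Longrightarrow> N x = 0 \<longleftrightarrow> x = 0"
  using is_norm by (simp add: is_norm_on_def)

lemma N_zero [simp]: "N 0 = 0"
  by (simp add: N_eq_0)

lemma N_scale: "x \<in> X \<Longrightarrow> N (c *\<^sub>R x) = \<bar>c\<bar> * N x"
  using is_norm by (simp add: is_norm_on_def)

lemma N_triangle: "x \<in> X \<Longrightarrow> y \<in> X \<Longrightarrow> N (x + y) \<le> N x + N y"
  using is_norm by (simp add: is_norm_on_def)

lemma N_minus: "x \<in> X \<Longrightarrow> N (- x) = N x"
  using N_scale[of x "-1"] by simp

lemma N_diff_le: "x \<in> X \<Longrightarrow> y \<in> X \<Longrightarrow> N (x - y) \<le> N x + N y"
  using N_triangle[of x "- y"] by (simp add: N_minus)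

lemma N_commute: "x \<in> X \<Longrightarrow> y \<in> X \<Longrightarrow> N (x - y) = N (y - x)"
  using N_minus[of "x - y"] by simp

lemma N_sum_le: "finite F \<Longrightarrow> (\<And>e. e \<in> F \<Longrightarrow> g e \<in> X) \<Longrightarrow> N (\<Sum>e\<in>F. g e) \<le> (\<Sum>e\<in>F. N (g e))"
proof (induction F rule: finite_induct)
  case (insert e F)
  then show ?case
    using N_triangle[of "g e" "\<Sum>e\<in>F. g e"] subspace_sum[OF subspace_carrier, of F g] by fastforce
qed simp

lemma convex_unit_ball: "convex (unit_ball X N)"
proof (rule convexI)
  fix x y and u v :: real
  assume *: "x \<in> unit_ball X N" "y \<in> unit_ball X N" "0 \<le> u" "0 \<le> v" "u + v = 1"
  have "N (u *\<^sub>R x + v *\<^sub>R y) \<le> u * N x + v * N y"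
    using * N_triangle[of "u *\<^sub>R x" "v *\<^sub>R y"] by (simp add: unit_ball_def N_scale)
  also have "\<dots> \<le> 1"
    using * by (intro convex_bound_le) (auto simp: unit_ball_def)
  finally show "u *\<^sub>R x + v *\<^sub>R y \<in> unit_ball X N"
    using * by (auto simp: unit_ball_def)
qed

sublocale metric: Metric_space X "\<lambda>x y. if x \<in> X \<and> y \<in> X then N (x - y) else 0"
  by (rule Metric_space_norm[OF subspace_carrier is_norm])

lemma closedin_norm_topology:
  "closedin (norm_topology X N) C \<longleftrightarrow>
     C \<subseteq> X \<and> (\<forall>x\<in>X - C. \<exists>r>0. \<forall>z\<in>C. r \<le> N (x - z))"
  unfolding norm_topology_def metric.closedin_metric disjnt_def
proof (intro conj_cong refl)
  assume C: "C \<subseteq> X"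
  have "C \<inter> metric.mball x r = {} \<longleftrightarrow> (\<forall>z\<in>C. r \<le> N (x - z))" if "x \<in> X" for x r
    using that C by (auto simp: metric.mball_def not_less)
  then show "(\<forall>x. x \<in> X - C \<longrightarrow> (\<exists>r>0. C \<inter> metric.mball x r = {})) \<longleftrightarrow>
      (\<forall>x\<in>X - C. \<exists>r>0. \<forall>z\<in>C. r \<le> N (x - z))"
    by auto
qed

lemma openin_norm_ball: "openin (norm_topology X N) {u \<in> X. N (u - x) < r}" if "x \<in> X"
proof -
  have "{u \<in> X. N (u - x) < r} = metric.mball x r"
    using that by (auto simp: metric.mball_def N_commute)
  then show ?thesis by (simp add: norm_topology_def)
qed

lemma unit_ball_closedin: "closedin (norm_topology X N) (unit_ball X N)"
  unfolding closedin_norm_topology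
proof (intro conjI ballI)
  fix x assume x: "x \<in> X - unit_ball X N"
  have "N x - 1 \<le> N (x - z)" if "z \<in> unit_ball X N" for z
    using that x N_triangle[of "x - z" z] by (simp add: unit_ball_def)
  then show "\<exists>r>0. \<forall>z\<in>unit_ball X N. r \<le> N (x - z)"
    using x by (intro exI[of _ "N x - 1"]) (auto simp: unit_ball_def)
qed (auto simp: unit_ball_def)

lemma dual_add: "\<phi> \<in> dual_space X N \<Longrightarrow> x \<in> X \<Longrightarrow> y \<in> X \<Longrightarrow> \<phi> (x + y) = \<phi> x + \<phi> y"
  by (simp add: dual_space_def is_linear_on_def)

lemma dual_scale: "\<phi> \<in> dual_space X N \<Longrightarrow> x \<in> X \<Longrightarrow> \<phi> (c *\<^sub>R x) = c * \<phi> x"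
  by (simp add: dual_space_def is_linear_on_def)

lemma dual_diff: "\<phi> \<in> dual_space X N \<Longrightarrow> x \<in> X \<Longrightarrow> y \<in> X \<Longrightarrow> \<phi> (x - y) = \<phi> x - \<phi> y"
  using dual_add[of \<phi> "x - y" y] by simp

lemma dual_bound: 
  assumes "\<phi> \<in> dual_space X N"
  obtains B where "B \<ge> 0" "\<And>x. x \<in> X \<Longrightarrow> \<bar>\<phi> x\<bar> \<le> B * N x"
proof -
  obtain B where B: "\<forall>x\<in>X. \<bar>\<phi> x\<bar> \<le> B * N x"
    using assms by (auto simp: dual_space_def)
  show ?thesis
  proof (rule that[of "max B 0"])
    fix x assume "x \<in> X"
    then show "\<bar>\<phi> x\<bar> \<le> max B 0 * N x"
      using B N_nonneg[of x] by (meson max.cobounded1 mult_right_mono order_trans)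
  qed simp
qed

lemma zero_in_dual: "(\<lambda>_. 0) \<in> dual_space X N"
  by (auto simp: dual_space_def is_linear_on_def intro: exI[of _ 0])

lemma add_scaled_in_dual:
  assumes "\<phi> \<in> dual_space X N" "\<psi> \<in> dual_space X N"
  shows "(\<lambda>x. \<phi> x + c * \<psi> x) \<in> dual_space X N"
proof -
  obtain A where A: "\<And>x. x \<in> X \<Longrightarrow> \<bar>\<phi> x\<bar> \<le> A * N x" using dual_bound[OF assms(1)] by metis
  obtain B where B: "\<And>x. x \<in> X \<Longrightarrow> \<bar>\<psi> x\<bar> \<le> B * N x" using dual_bound[OF assms(2)] by metis
  have "\<bar>\<phi> x + c * \<psi> x\<bar> \<le> (A + \<bar>c\<bar> * B) * N x" if "x \<in> X" for x
  proof -
    have "\<bar>\<phi> x + c * \<psi> x\<bar> \<le> \<bar>\<phi> x\<bar> + \<bar>c\<bar> * \<bar>\<psi> x\<bar>"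
      by (metis abs_mult abs_triangle_ineq)
    also have "\<dots> \<le> A * N x + \<bar>c\<bar> * (B * N x)"
      using A[OF that] B[OF that] by (intro add_mono mult_left_mono) auto
    finally show ?thesis by (simp add: algebra_simps)
  qed
  then have "\<exists>B. \<forall>x\<in>X. \<bar>\<phi> x + c * \<psi> x\<bar> \<le> B * N x" by blast
  then show ?thesis
    using assms by (simp add: dual_space_def is_linear_on_def algebra_simps)
qed

lemma sum_in_dual:
  assumes "finite H" "H \<subseteq> dual_space X N"
  shows "(\<lambda>x. \<Sum>\<phi>\<in>H. c \<phi> * \<phi> x) \<in> dual_space X N"
  using assms
proof (induction H rule: finite_induct)
  case empty
  then show ?case using zero_in_dual by simp
next
  case (insert \<phi> H)
  then have "(\<lambda>x. (\<Sum>\<phi>\<in>H. c \<phi> * \<phi> x) + c \<phi> * \<phi> x) \<in> dual_space X N"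
    by (intro add_scaled_in_dual) auto
  then show ?case using insert by (simp add: add.commute)
qed

section \<open>Slices of the ball of a Daugavet space\<close>

lemma dual_bdd_on_ball:
  assumes "\<phi> \<in> dual_space X N"
  obtains B where "B > 0" "\<And>x. x \<in> unit_ball X N \<Longrightarrow> \<bar>\<phi> x\<bar> \<le> B"
proof -
  obtain B where B: "B \<ge> 0" "\<And>x. x \<in> X \<Longrightarrow> \<bar>\<phi> x\<bar> \<le> B * N x" using dual_bound[OF assms] by metis
  show ?thesis
  proof (rule that[of "B + 1"])
    fix x assume "x \<in> unit_ball X N"
    then have "x \<in> X" "B * N x \<le> B * 1"
      using B(1) by (auto simp: unit_ball_def intro!: mult_left_mono simp del: mult_1_right)
    then show "\<bar>\<phi> x\<bar> \<le> B + 1" using B(2)[of x] by simp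
  qed (use B in simp)
qed

lemma unit_vector_exists:
  assumes "X \<noteq> {0}" "y \<in> X"
  obtains y' where "y' \<in> X" "N y' = 1" "y = N y *\<^sub>R y'"
proof (cases "y = 0")
  case True
  obtain w where w: "w \<in> X" "w \<noteq> 0" using assms carrier_closed(1) by blast
  then have "N w > 0" using N_nonneg[of w] N_eq_0[of w] by linarith
  then have "N ((1 / N w) *\<^sub>R w) = 1" using w by (simp add: N_scale)
  then show ?thesis using that[of "(1 / N w) *\<^sub>R w"] w True by simp
next
  case False
  then have "N y > 0" using assms N_nonneg[of y] N_eq_0[of y] by linarith
  then show ?thesis using that[of "(1 / N y) *\<^sub>R y"] assms by (simp add: N_scale)
qed

text \<open>Apply the Daugavet equation to the norm one operator \<open>x \<mapsto> (\<psi> x / \<sigma>) y\<close>. A point at which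
  \<open>x + T x\<close> almost attains the norm two has \<open>\<bar>\<psi> x\<bar>\<close> almost equal to \<open>\<sigma>\<close>, so that up to its sign it lies
  in the slice, and \<open>T x\<close> may be replaced by \<open>y\<close>.\<close>

lemma daugavet_slice_aux:
  assumes dp: "daugavet_property X N"
    and \<psi>: "\<psi> \<in> dual_space X N" and nz: "x\<^sub>1 \<in> X" "\<psi> x\<^sub>1 \<noteq> 0"
    and y: "y \<in> X" "N y = 1" and \<delta>: "0 < \<delta>" "\<delta> < 1"
  defines "\<sigma> \<equiv> SUP x\<in>unit_ball X N. \<psi> x"
  shows "0 < \<sigma>" "\<And>x. x \<in> unit_ball X N \<Longrightarrow> \<psi> x \<le> \<sigma>"
    "\<exists>u\<in>unit_ball X N. \<sigma> * (1 - \<delta>) \<le> \<psi> u \<and> 2 - 2 * \<delta> \<le> N (u + y)"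
proof -
  let ?B = "unit_ball X N"
  obtain B where B: "B > 0" "\<And>x. x \<in> ?B \<Longrightarrow> \<bar>\<psi> x\<bar> \<le> B" using dual_bdd_on_ball[OF \<psi>] by metis
  have "bdd_above (\<psi> ` ?B)"
    using B(2) by (intro bdd_aboveI[of _ B]) (auto simp: abs_le_iff)
  then show up: "\<psi> x \<le> \<sigma>" if "x \<in> ?B" for x
    using that unfolding \<sigma>_def by (intro cSUP_upper)
  have neg: "- x \<in> ?B" if "x \<in> ?B" for x
    using that by (simp add: unit_ball_def N_minus)
  have \<psi>neg: "\<psi> (- x) = - \<psi> x" if "x \<in> X" for x
    using dual_scale[OF \<psi> that, of "-1"] by simp
  have up': "\<bar>\<psi> x\<bar> \<le> \<sigma>" if "x \<in> ?B" for x
    using up[OF that] up[OF neg[OF that]] \<psi>neg that by (auto simp: unit_ball_def)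
  have "N x\<^sub>1 > 0"
    using nz N_nonneg[of x\<^sub>1] N_eq_0[of x\<^sub>1] dual_scale[OF \<psi>, of x\<^sub>1 0] by force
  then have "(1 / N x\<^sub>1) *\<^sub>R x\<^sub>1 \<in> ?B" "\<psi> ((1 / N x\<^sub>1) *\<^sub>R x\<^sub>1) \<noteq> 0"
    using nz \<psi> by (auto simp: unit_ball_def N_scale dual_scale)
  then show \<sigma>: "0 < \<sigma>"
    using up' by (metis less_le_trans zero_less_abs_iff)
  define T where "T x = (\<psi> x / \<sigma>) *\<^sub>R y" for x
  have NT: "N (T x) = \<bar>\<psi> x\<bar> / \<sigma>" if "x \<in> X" for x
    using that y \<sigma> by (simp add: T_def N_scale)
  have TX: "T x \<in> X" for x using y by (auto simp: T_def)
  have bop: "bounded_operator X N T"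
    unfolding bounded_operator_def
  proof (intro conjI)
    show "is_linear_on X T"
      using \<psi> by (auto simp: is_linear_on_def T_def dual_add dual_scale add_divide_distrib scaleR_add_left)
    obtain C where C: "\<And>x. x \<in> X \<Longrightarrow> \<bar>\<psi> x\<bar> \<le> C * N x" using dual_bound[OF \<psi>] by metis
    show "\<exists>B. \<forall>x\<in>X. N (T x) \<le> B * N x"
      using C \<sigma> by (intro exI[of _ "C / \<sigma>"]) (auto simp: NT divide_right_mono)
  qed (use TX in auto)
  have "T ` X = span {y}"
  proof
    show "T ` X \<subseteq> span {y}" by (auto simp: T_def span_singleton)
    show "span {y} \<subseteq> T ` X"
    proof
      fix v assume "v \<in> span {y}"
      then obtain c where c: "v = c *\<^sub>R y" by (auto simp: span_singleton)
      have "T ((c * \<sigma> / \<psi> x\<^sub>1) *\<^sub>R x\<^sub>1) = v"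
        using nz \<sigma> by (simp add: T_def c dual_scale[OF \<psi>])
      then show "v \<in> T ` X" using nz by blast
    qed
  qed
  moreover have "y \<noteq> 0" using y by auto
  ultimately have "dim (T ` X) = 1"
    by (simp add: dim_eq_card_independent dependent_single)
  then have eq: "op_norm X N (\<lambda>x. x + T x) = op_norm X N (\<lambda>x. x) + op_norm X N T"
    using dp bop by (simp add: daugavet_property_def)
  have "bdd_above ((\<lambda>x. N (T x)) ` ?B)"
    using up' \<sigma> by (intro bdd_aboveI[of _ 1]) (auto simp: NT unit_ball_def)
  then have *: "N (T x) \<le> op_norm X N T" if "x \<in> ?B" for x
    unfolding op_norm_def using that by (intro cSUP_upper)
  then have "\<psi> x \<le> \<sigma> * op_norm X N T" if "x \<in> ?B" for x
  proof -
    have "\<bar>\<psi> x\<bar> / \<sigma> \<le> op_norm X N T"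
      using * [OF that] NT[of x] that by (simp add: unit_ball_def)
    then show ?thesis using \<sigma> by (simp add: field_simps abs_le_iff)
  qed
  then have "\<sigma> \<le> \<sigma> * op_norm X N T"
    unfolding \<sigma>_def using y by (intro cSUP_least) (auto simp: unit_ball_def)
  then have 1: "1 \<le> op_norm X N T" using \<sigma> by simp
  have "bdd_above (N ` ?B)" by (intro bdd_aboveI[of _ 1]) (auto simp: unit_ball_def)
  then have "N y \<le> op_norm X N (\<lambda>x. x)"
    unfolding op_norm_def using y by (intro cSUP_upper) (auto simp: unit_ball_def)
  then have "2 - \<delta> < op_norm X N (\<lambda>x. x + T x)"
    using eq 1 y \<delta> by simp
  moreover have le: "N (x + T x) \<le> N x + \<bar>\<psi> x\<bar> / \<sigma>" if "x \<in> X" for x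
    using N_triangle[OF that TX[of x]] NT[OF that] by simp
  have "bdd_above ((\<lambda>x. N (x + T x)) ` ?B)"
  proof (rule bdd_aboveI2)
    fix x assume "x \<in> ?B"
    then show "N (x + T x) \<le> 1 + 1"
      using up'[of x] \<sigma> by (intro order_trans[OF le] add_mono) (auto simp: unit_ball_def)
  qed
  ultimately obtain x where x: "x \<in> ?B" "2 - \<delta> < N (x + T x)"
    unfolding op_norm_def using y by (subst (asm) less_cSUP_iff) (auto simp: unit_ball_def)
  define c where "c = \<psi> x / \<sigma>"
  have xX: "x \<in> X" "N x \<le> 1" using x by (auto simp: unit_ball_def)
  have c: "\<bar>c\<bar> \<le> 1" "1 - \<delta> < \<bar>c\<bar>"
    using up'[OF x(1)] \<sigma> le[OF xX(1)] xX x(2) by (auto simp: c_def)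
  have "\<exists>u\<in>?B. \<psi> u = \<sigma> * \<bar>c\<bar> \<and> N (u + \<bar>c\<bar> *\<^sub>R y) = N (x + c *\<^sub>R y)"
  proof (cases "c \<ge> 0")
    case True
    then have "\<bar>c\<bar> = c" by simp
    moreover have "\<psi> x = \<sigma> * c" using \<sigma> by (simp add: c_def)
    ultimately show ?thesis using x(1) by (intro bexI[of _ x]) auto
  next
    case False
    then have "N (- x + \<bar>c\<bar> *\<^sub>R y) = N (- (x + c *\<^sub>R y))" by simp
    also have "\<dots> = N (x + c *\<^sub>R y)" using xX y by (intro N_minus) auto
    finally have "N (- x + \<bar>c\<bar> *\<^sub>R y) = N (x + c *\<^sub>R y)" .
    moreover have "\<psi> (- x) = \<sigma> * \<bar>c\<bar>"
    proof -
      have "\<bar>c\<bar> = - c" using False by simp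
      then show ?thesis using \<sigma> \<psi>neg[OF xX(1)] by (simp add: c_def)
    qed
    ultimately show ?thesis using x(1) neg by (intro bexI[of _ "- x"]) auto
  qed
  then obtain u where u: "u \<in> ?B" "\<psi> u = \<sigma> * \<bar>c\<bar>" "N (u + \<bar>c\<bar> *\<^sub>R y) = N (x + c *\<^sub>R y)" by blast
  have "N (u + \<bar>c\<bar> *\<^sub>R y) = N ((u + y) - (1 - \<bar>c\<bar>) *\<^sub>R y)"
    by (simp add: algebra_simps)
  also have "\<dots> \<le> N (u + y) + (1 - \<bar>c\<bar>)"
    using N_diff_le[of "u + y" "(1 - \<bar>c\<bar>) *\<^sub>R y"] u(1) y c by (auto simp: N_scale unit_ball_def)
  finally have "2 - 2 * \<delta> \<le> N (u + y)" using u(3) x(2) c by (simp add: T_def c_def)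
  moreover have "\<sigma> * (1 - \<delta>) \<le> \<psi> u" using c \<sigma> u by simp
  ultimately show "\<exists>u\<in>?B. \<sigma> * (1 - \<delta>) \<le> \<psi> u \<and> 2 - 2 * \<delta> \<le> N (u + y)"
    using u(1) by blast
qed

text \<open>If the norm is almost additive on \<open>u\<close> and \<open>y\<close>, it is so on their nonnegative multiples: the
  larger multiple is split into a common multiple of \<open>u + y\<close> and a rest, and the rest costs at most
  its coefficient.\<close>

lemma almost_additive_scaling:
  assumes u: "u \<in> X" "N u \<le> 1" and y: "y \<in> X" "N y \<le> 1"
    and ge: "2 - 2 * \<delta> \<le> N (u + y)" and nn: "0 \<le> \<delta>" "0 \<le> a" "0 \<le> s"
  shows "a + s - 2 * \<delta> * (a + s) \<le> N (a *\<^sub>R y + s *\<^sub>R u)"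
proof (cases "s \<le> a")
  case True
  have "a * (2 - 2 * \<delta>) \<le> N (a *\<^sub>R (u + y))"
    using ge u y nn by (simp add: N_scale mult_left_mono)
  also have "a *\<^sub>R (u + y) = (a *\<^sub>R y + s *\<^sub>R u) + (a - s) *\<^sub>R u"
    by (simp add: algebra_simps)
  also have "N \<dots> \<le> N (a *\<^sub>R y + s *\<^sub>R u) + (a - s) * N u"
    using N_triangle[of "a *\<^sub>R y + s *\<^sub>R u" "(a - s) *\<^sub>R u"] u y True by (simp add: N_scale)
  also have "(a - s) * N u \<le> a - s"
    using True u(2) by (intro mult_left_le) auto
  moreover have "0 \<le> \<delta> * s" using nn by simp
  ultimately show ?thesis by (simp add: algebra_simps)
next
  case False
  have "s * (2 - 2 * \<delta>) \<le> N (s *\<^sub>R (u + y))"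
    using ge u y nn by (simp add: N_scale mult_left_mono)
  also have "s *\<^sub>R (u + y) = (a *\<^sub>R y + s *\<^sub>R u) + (s - a) *\<^sub>R y"
    by (simp add: algebra_simps)
  also have "N \<dots> \<le> N (a *\<^sub>R y + s *\<^sub>R u) + (s - a) * N y"
    using N_triangle[of "a *\<^sub>R y + s *\<^sub>R u" "(s - a) *\<^sub>R y"] u y False by (simp add: N_scale)
  also have "(s - a) * N y \<le> s - a"
    using False y(2) by (intro mult_left_le) auto
  moreover have "0 \<le> \<delta> * a" using nn by simp
  ultimately show ?thesis by (simp add: algebra_simps)
qed

text \<open>The form in which the Daugavet Property is used. Since \<open>y\<close> and \<open>s\<close> are arbitrary, the conclusion
  can be applied again to the vector \<open>y + s u\<close> that it produces.\<close>

lemma daugavet_slice: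
  assumes dp: "daugavet_property X N" and X: "X \<noteq> {0}"
    and \<psi>: "\<psi> \<in> dual_space X N" and u\<^sub>0: "u\<^sub>0 \<in> unit_ball X N" "\<alpha> < \<psi> u\<^sub>0"
    and y: "y \<in> X" and s: "0 \<le> s" and \<epsilon>: "0 < \<epsilon>"
  shows "\<exists>u\<in>unit_ball X N. \<alpha> < \<psi> u \<and> N y + s - \<epsilon> \<le> N (y + s *\<^sub>R u)"
proof -
  obtain y' where y': "y' \<in> X" "N y' = 1" "y = N y *\<^sub>R y'"
    using unit_vector_exists[OF X y] .
  have Ny: "0 \<le> N y" using y by (rule N_nonneg)
  show ?thesis
  proof (cases "\<exists>x\<in>X. \<psi> x \<noteq> 0")
    case False
    have "N (y + s *\<^sub>R y') = N ((N y + s) *\<^sub>R y')"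
      by (subst y'(3)) (simp add: scaleR_add_left)
    also have "\<dots> = N y + s" using y' Ny s by (simp add: N_scale)
    finally show ?thesis
      using False u\<^sub>0 y' \<epsilon> by (intro bexI[of _ y']) (auto simp: unit_ball_def)
  next
    case True
    then obtain x\<^sub>1 where x\<^sub>1: "x\<^sub>1 \<in> X" "\<psi> x\<^sub>1 \<noteq> 0" by blast
    define \<sigma> where "\<sigma> = (SUP x\<in>unit_ball X N. \<psi> x)"
    note aux = daugavet_slice_aux[OF dp \<psi> x\<^sub>1 y'(1,2), folded \<sigma>_def]
    have \<sigma>: "0 < \<sigma>" "\<alpha> < \<sigma>"
      using aux(1)[of "1/2"] aux(2)[of "1/2" u\<^sub>0] u\<^sub>0 by auto
    define \<delta> where "\<delta> = Min {1/2, (\<sigma> - \<alpha>) / (2 * \<sigma>), \<epsilon> / (2 * (N y + s + 1))}"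
    have \<delta>: "0 < \<delta>" "\<delta> < 1" "\<delta> \<le> (\<sigma> - \<alpha>) / (2 * \<sigma>)" "\<delta> \<le> \<epsilon> / (2 * (N y + s + 1))"
      unfolding \<delta>_def using \<sigma> \<epsilon> Ny s by auto
    obtain u where u: "u \<in> unit_ball X N" "\<sigma> * (1 - \<delta>) \<le> \<psi> u" "2 - 2 * \<delta> \<le> N (u + y')"
      using aux(3)[OF \<delta>(1,2)] by blast
    have "\<alpha> < \<sigma> * (1 - \<delta>)" using \<delta>(3) \<sigma> by (simp add: field_simps)
    moreover have "2 * \<delta> * (N y + s) \<le> \<epsilon>"
    proof -
      have "2 * \<delta> * (N y + s + 1) \<le> \<epsilon>" using \<delta>(4) Ny s by (simp add: field_simps)
      moreover have "2 * \<delta> * (N y + s) \<le> 2 * \<delta> * (N y + s + 1)" using \<delta>(1) by simp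
      ultimately show ?thesis by linarith
    qed
    moreover have "N y + s - 2 * \<delta> * (N y + s) \<le> N (N y *\<^sub>R y' + s *\<^sub>R u)"
      using u y' \<delta>(1) Ny s by (intro almost_additive_scaling) (auto simp: unit_ball_def)
    ultimately show ?thesis using u y'(3) by (intro bexI[of _ u]) auto
  qed
qed

section \<open>Weakly open subsets of the ball of a Daugavet space\<close>

text \<open>The semidefinite form that \<open>H\<close> induces. It stands for the inner product of the image of \<open>X\<close>
  under the map \<open>x \<mapsto> (\<phi> x)\<^sub>\<phi>\<close> into a Euclidean space whose dimension depends on \<open>H\<close>.\<close>

definition inner_on :: "('a \<Rightarrow> real) set \<Rightarrow> 'a \<Rightarrow> 'a \<Rightarrow> real" where
  "inner_on H x y = (\<Sum>\<phi>\<in>H. \<phi> x * \<phi> y)"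

context
  fixes H assumes H: "finite H" "H \<subseteq> dual_space X N"
begin

lemma inner_on_in_dual: "inner_on H x \<in> dual_space X N"
  using sum_in_dual[OF H, of "\<lambda>\<phi>. \<phi> x"] by (simp add: inner_on_def[abs_def])

lemma inner_on_expand:
  assumes "x \<in> X" "y \<in> X"
  shows "inner_on H (x + c *\<^sub>R y) (x + c *\<^sub>R y) = inner_on H x x + 2 * c * inner_on H x y + c\<^sup>2 * inner_on H y y"
proof -
  have "\<phi> (x + c *\<^sub>R y) * \<phi> (x + c *\<^sub>R y) = \<phi> x * \<phi> x + 2 * c * (\<phi> x * \<phi> y) + c\<^sup>2 * (\<phi> y * \<phi> y)" if "\<phi> \<in> H" for \<phi>
  proof -
    have "\<phi> \<in> dual_space X N" using that H by blast
    then have "\<phi> (x + c *\<^sub>R y) = \<phi> x + c * \<phi> y" using assms by (simp add: dual_add dual_scale)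
    then show ?thesis by (simp add: power2_eq_square algebra_simps)
  qed
  then show ?thesis
    by (simp add: inner_on_def sum.distrib sum_distrib_left cong: sum.cong)
qed

lemma inner_on_self_nonneg: "0 \<le> inner_on H x x"
  unfolding inner_on_def by (intro sum_nonneg) simp

lemma le_inner_on_self: "\<phi> \<in> H \<Longrightarrow> (\<phi> x)\<^sup>2 \<le> inner_on H x x"
  unfolding inner_on_def power2_eq_square using H(1)
  by (intro member_le_sum[of \<phi> H "\<lambda>\<phi>. \<phi> x * \<phi> x"]) auto

lemma inner_on_bounded:
  obtains M where "M > 0" "\<And>x y. x \<in> unit_ball X N \<Longrightarrow> y \<in> unit_ball X N \<Longrightarrow> \<bar>inner_on H x y\<bar> \<le> M"
proof -
  have "\<forall>\<phi>\<in>H. \<exists>B>0. \<forall>x\<in>unit_ball X N. \<bar>\<phi> x\<bar> \<le> B"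
    using H dual_bdd_on_ball by (metis subsetD)
  then obtain b where b: "\<And>\<phi>. \<phi> \<in> H \<Longrightarrow> b \<phi> > 0" "\<And>\<phi> x. \<phi> \<in> H \<Longrightarrow> x \<in> unit_ball X N \<Longrightarrow> \<bar>\<phi> x\<bar> \<le> b \<phi>"
    by metis
  show ?thesis
  proof (rule that[of "1 + (\<Sum>\<phi>\<in>H. b \<phi> * b \<phi>)"])
    show "1 + (\<Sum>\<phi>\<in>H. b \<phi> * b \<phi>) > 0" by (intro add_pos_nonneg sum_nonneg) auto
    fix x y assume xy: "x \<in> unit_ball X N" "y \<in> unit_ball X N"
    have "\<bar>inner_on H x y\<bar> \<le> (\<Sum>\<phi>\<in>H. \<bar>\<phi> x * \<phi> y\<bar>)" unfolding inner_on_def by (rule sum_abs)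
    also have "\<dots> \<le> (\<Sum>\<phi>\<in>H. b \<phi> * b \<phi>)"
      using b xy by (intro sum_mono) (auto simp: abs_mult less_imp_le intro!: mult_mono)
    finally show "\<bar>inner_on H x y\<bar> \<le> 1 + (\<Sum>\<phi>\<in>H. b \<phi> * b \<phi>)" by simp
  qed
qed

text \<open>A point of a convex body at maximal distance from a given centre lies in small slices. Here the
  linear functional \<open>\<psi>\<close> is perturbed by a small multiple of the quadratic form, and \<open>\<psi>'\<close> is the
  derivative of the perturbed function at an almost maximal point \<open>w\<close>: the second order term bounds
  the distance from \<open>w\<close> on the slice of \<open>\<psi>'\<close>.\<close>

lemma slice_contains_small_slice:
  assumes \<psi>: "\<psi> \<in> dual_space X N" and u\<^sub>0: "u\<^sub>0 \<in> unit_ball X N" "\<alpha> < \<psi> u\<^sub>0" and \<rho>: "0 < \<rho>"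
  shows "\<exists>w\<in>unit_ball X N. \<exists>\<psi>'\<in>dual_space X N. \<exists>\<alpha>'. \<alpha>' < \<psi>' w \<and>
    (\<forall>u\<in>unit_ball X N. \<alpha>' < \<psi>' u \<longrightarrow> \<alpha> < \<psi> u \<and> (\<forall>\<phi>\<in>H. \<bar>\<phi> (u - w)\<bar> < \<rho>))"
proof -
  let ?B = "unit_ball X N"
  obtain M where M: "M > 0" "\<And>x y. x \<in> ?B \<Longrightarrow> y \<in> ?B \<Longrightarrow> \<bar>inner_on H x y\<bar> \<le> M"
    using inner_on_bounded by metis
  obtain B where B: "B > 0" "\<And>x. x \<in> ?B \<Longrightarrow> \<bar>\<psi> x\<bar> \<le> B" using dual_bdd_on_ball[OF \<psi>] by metis
  \<comment> \<open>\<open>\<kappa>\<close> makes the perturbation cost at most \<open>g / 8\<close> each time it occurs, and \<open>2 \<eta> / \<kappa> \<le> \<rho>\<^sup>2\<close>.\<close>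
  define g where "g = \<psi> u\<^sub>0 - \<alpha>"
  define \<kappa> where "\<kappa> = g / (8 * M)"
  define \<eta> where "\<eta> = min (g / 8) (\<kappa> * \<rho>\<^sup>2 / 2)"
  have pos: "0 < g" "0 < \<kappa>" "0 < \<eta>" and \<eta>: "\<eta> \<le> g / 8" "\<eta> \<le> \<kappa> * \<rho>\<^sup>2 / 2" and \<kappa>M: "\<kappa> * M = g / 8"
    using u\<^sub>0 M \<rho> unfolding \<eta>_def min_le_iff_disj by (auto simp: g_def \<kappa>_def)
  define F where "F u = \<psi> u + \<kappa> * inner_on H u u" for u
  have bdd: "bdd_above (F ` ?B)"
  proof (rule bdd_aboveI2)
    fix u assume "u \<in> ?B"
    then have "\<psi> u \<le> B" "\<kappa> * inner_on H u u \<le> \<kappa> * M"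
      using B(2)[of u] M(2)[of u u] pos by (auto simp: abs_le_iff)
    then show "F u \<le> B + \<kappa> * M" by (simp add: F_def)
  qed
  have "(SUP u\<in>?B. F u) - \<eta> < (SUP u\<in>?B. F u)" using pos by simp
  then obtain w where w: "w \<in> ?B" "(SUP u\<in>?B. F u) - \<eta> < F w"
    using bdd u\<^sub>0 by (subst (asm) less_cSUP_iff) auto
  have F: "F u < F w + \<eta>" if "u \<in> ?B" for u
    using cSUP_upper[OF that bdd] w(2) by linarith
  define \<psi>' where "\<psi>' u = \<psi> u + (2 * \<kappa>) * inner_on H w u" for u
  have \<psi>': "\<psi>' \<in> dual_space X N"
    unfolding \<psi>'_def[abs_def] using \<psi> inner_on_in_dual by (rule add_scaled_in_dual)
  have "\<alpha> < \<psi> u \<and> (\<forall>\<phi>\<in>H. \<bar>\<phi> (u - w)\<bar> < \<rho>)" if u: "u \<in> ?B" "\<psi>' w - \<eta> < \<psi>' u" for u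
  proof
    have uw: "u \<in> X" "w \<in> X" using u w by (auto simp: unit_ball_def)
    have ww: "inner_on H w (u - w) = inner_on H w u - inner_on H w w"
      using dual_diff[OF inner_on_in_dual] uw by simp
    have ex: "inner_on H u u = inner_on H w w + 2 * inner_on H w (u - w) + inner_on H (u - w) (u - w)"
      using inner_on_expand[of w "u - w" 1] uw by simp
    have "\<kappa> * inner_on H u u = \<kappa> * inner_on H w w + 2 * \<kappa> * inner_on H w u - 2 * \<kappa> * inner_on H w w
        + \<kappa> * inner_on H (u - w) (u - w)"
      unfolding ex ww by (simp add: algebra_simps)
    then have "\<kappa> * inner_on H (u - w) (u - w) < 2 * \<eta>"
      using F[OF u(1)] u(2) unfolding F_def \<psi>'_def by linarith
    also have "\<dots> \<le> \<kappa> * \<rho>\<^sup>2" using \<eta> by simp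
    finally have "inner_on H (u - w) (u - w) < \<rho>\<^sup>2" using pos by simp
    then show "\<forall>\<phi>\<in>H. \<bar>\<phi> (u - w)\<bar> < \<rho>"
      using le_inner_on_self \<rho> by (metis abs_le_square_iff abs_of_pos le_less_trans not_le)
    have 1: "\<kappa> * inner_on H x y \<le> g / 8" if "x \<in> ?B" "y \<in> ?B" for x y
      using M(2)[OF that] pos \<kappa>M by (metis abs_le_iff mult_le_cancel_left_pos)
    have 2: "0 \<le> \<kappa> * inner_on H w w" "0 \<le> \<kappa> * inner_on H u\<^sub>0 u\<^sub>0"
      using pos inner_on_self_nonneg by auto
    define a b c where "a = \<kappa> * inner_on H w w" and "b = \<kappa> * inner_on H w u"
      and "c = \<kappa> * inner_on H u\<^sub>0 u\<^sub>0"
    have "\<psi> u\<^sub>0 + c < \<psi> w + a + \<eta>" "\<psi> w + 2 * a - \<eta> < \<psi> u + 2 * b"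
      using F[OF u\<^sub>0(1)] u(2) by (simp_all add: F_def \<psi>'_def a_def b_def c_def)
    moreover have "b \<le> g / 8" "0 \<le> a" "0 \<le> c"
      using 1[OF w(1) u(1)] 2 by (simp_all add: a_def b_def c_def)
    ultimately have "\<psi> u\<^sub>0 - g / 2 < \<psi> u" using \<eta>(1) by simp
    then show "\<alpha> < \<psi> u" using pos(1) by (simp add: g_def field_simps)
  qed
  then show ?thesis
    using w(1) \<psi>' pos(3) by (intro bexI[of _ w] bexI[of _ \<psi>'] exI[of _ "\<psi>' w - \<eta>"]) auto
qed

text \<open>Separation by the nearest point: if \<open>A\<close> stays away from \<open>x\<close> in the seminorm of the form, take an
  almost nearest \<open>u \<in> A\<close>. The functional given by \<open>x - u\<close> is much larger at \<open>x\<close> than at \<open>u\<close>, so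
  a slice containing \<open>x\<close> yields \<open>v \<in> A\<close> such that moving from \<open>u\<close> towards \<open>v\<close> decreases the
  distance from \<open>x\<close>.\<close>

lemma convex_meeting_slices_dense:
  assumes A: "convex A" "A \<subseteq> unit_ball X N"
    and meets: "\<And>\<psi> \<alpha> u\<^sub>0. \<psi> \<in> dual_space X N \<Longrightarrow> u\<^sub>0 \<in> unit_ball X N \<Longrightarrow> \<alpha> < \<psi> u\<^sub>0 \<Longrightarrow> \<exists>u\<in>A. \<alpha> < \<psi> u"
    and x: "x \<in> unit_ball X N" and \<rho>: "0 < \<rho>"
  shows "\<exists>u\<in>A. \<forall>\<phi>\<in>H. \<bar>\<phi> (u - x)\<bar> < \<rho>"
proof (rule ccontr)
  assume far: "\<not> ?thesis"
  let ?q = "\<lambda>u. inner_on H (u - x) (u - x)"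
  have q: "\<rho>\<^sup>2 \<le> ?q u" if u: "u \<in> A" for u
  proof -
    obtain \<phi> where \<phi>: "\<phi> \<in> H" "\<rho> \<le> \<bar>\<phi> (u - x)\<bar>" using far u by (auto simp: not_less)
    then have "\<rho>\<^sup>2 \<le> (\<phi> (u - x))\<^sup>2" using \<rho> by (metis abs_le_square_iff abs_of_pos)
    then show ?thesis using le_inner_on_self[OF \<phi>(1), of "u - x"] by linarith
  qed
  have "A \<noteq> {}" using meets[OF zero_in_dual x, of "-1"] by auto
  have bdd: "bdd_below (?q ` A)" using inner_on_self_nonneg by (intro bdd_belowI2[of _ 0])
  define m where "m = (INF u\<in>A. ?q u)"
  obtain M where M: "M > 0" "\<And>x y. x \<in> unit_ball X N \<Longrightarrow> y \<in> unit_ball X N \<Longrightarrow> \<bar>inner_on H x y\<bar> \<le> M"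
    using inner_on_bounded by metis
  \<comment> \<open>For this step length the first order gain \<open>s \<rho>\<^sup>2\<close> outweighs the second order loss, which is at most half of it; the other half absorbs the error in the choice of \<open>u\<close>.\<close>
  define s where "s = min 1 (\<rho>\<^sup>2 / (8 * M))"
  have s: "0 < s" "s \<le> 1" "s * (4 * M) \<le> \<rho>\<^sup>2 / 2"
    using \<rho> M by (auto simp: s_def min_def field_simps)
  have "m < m + s * \<rho>\<^sup>2 / 2" using s \<rho> by simp
  then obtain u where u: "u \<in> A" "?q u < m + s * \<rho>\<^sup>2 / 2"
    unfolding m_def using bdd \<open>A \<noteq> {}\<close> by (subst (asm) cINF_less_iff) auto
  have X: "u \<in> X" "x \<in> X" using u A x by (auto simp: unit_ball_def)
  let ?\<psi> = "inner_on H (x - u)"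
  have "?\<psi> u + \<rho>\<^sup>2 / 2 < ?\<psi> x"
  proof -
    have "?\<psi> x - ?\<psi> u = ?\<psi> (x - u)" using dual_diff[OF inner_on_in_dual] X by simp
    also have "\<dots> = ?q u"
      unfolding inner_on_def using H(2) X by (intro sum.cong) (auto simp: dual_diff subset_iff algebra_simps)
    finally show ?thesis using q[OF u(1)] zero_less_power[OF \<rho>, of 2] by linarith
  qed
  then obtain v where v: "v \<in> A" "?\<psi> u + \<rho>\<^sup>2 / 2 < ?\<psi> v"
    using meets[OF inner_on_in_dual x] by blast
  have vX: "v \<in> X" using v A by (auto simp: unit_ball_def)
  have "(1 - s) *\<^sub>R u + s *\<^sub>R v \<in> A"
    using A(1) u(1) v(1) s by (intro convexD) auto
  then have "m \<le> ?q ((1 - s) *\<^sub>R u + s *\<^sub>R v)"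
    unfolding m_def using bdd by (intro cINF_lower)
  also have "(1 - s) *\<^sub>R u + s *\<^sub>R v - x = (u - x) + s *\<^sub>R (v - u)" by (simp add: algebra_simps)
  also have "inner_on H \<dots> \<dots> = ?q u + 2 * s * inner_on H (u - x) (v - u) + s\<^sup>2 * inner_on H (v - u) (v - u)"
    using X vX by (intro inner_on_expand) auto
  also have "inner_on H (u - x) (v - u) = ?\<psi> u - ?\<psi> v"
  proof -
    have "inner_on H (u - x) (v - u) = - ?\<psi> (v - u)"
      unfolding inner_on_def sum_negf[symmetric]
      using H(2) X by (intro sum.cong) (auto simp: dual_diff subset_iff algebra_simps)
    then show ?thesis using dual_diff[OF inner_on_in_dual] X vX by simp
  qed
  finally have 1: "m \<le> ?q u + 2 * s * (?\<psi> u - ?\<psi> v) + s\<^sup>2 * inner_on H (v - u) (v - u)" .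
  have "2 * s * (?\<psi> u - ?\<psi> v) \<le> 2 * s * (- (\<rho>\<^sup>2 / 2))"
    using v s by (intro mult_left_mono) auto
  moreover have "s\<^sup>2 * inner_on H (v - u) (v - u) \<le> s * (\<rho>\<^sup>2 / 2)"
  proof -
    have "inner_on H (v - u) (v - u) = inner_on H v v - 2 * inner_on H v u + inner_on H u u"
      using inner_on_expand[of v u "-1"] X vX by simp
    also have "\<dots> \<le> 4 * M"
      using M(2)[of v v] M(2)[of v u] M(2)[of u u] u(1) v(1) A(2) by (auto simp: abs_le_iff subset_iff)
    finally have "s * inner_on H (v - u) (v - u) \<le> s * (4 * M)" using s by (intro mult_left_mono) auto
    then have "s * inner_on H (v - u) (v - u) \<le> \<rho>\<^sup>2 / 2" using s(3) by linarith
    then have "s * (s * inner_on H (v - u) (v - u)) \<le> s * (\<rho>\<^sup>2 / 2)"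
      using s by (intro mult_left_mono) auto
    then show ?thesis by (simp add: power2_eq_square mult.assoc)
  qed
  ultimately show False using 1 u(2) by simp
qed

text \<open>Shvydkoy's theorem: the set \<open>A\<close> in the proof is convex and meets every slice, hence contains a
  point near \<open>x\<close>; the property that defines \<open>A\<close> is then used with \<open>y = - x\<close> and \<open>s = 1\<close>.\<close>

theorem daugavet_weak_neighbourhood:
  assumes dp: "daugavet_property X N" and X: "X \<noteq> {0}"
    and x: "x \<in> unit_ball X N" and \<rho>: "0 < \<rho>" and \<epsilon>: "0 < \<epsilon>"
  shows "\<exists>u\<in>unit_ball X N. (\<forall>\<phi>\<in>H. \<bar>\<phi> (u - x)\<bar> < \<rho>) \<and> N x + 1 - \<epsilon> \<le> N (u - x)"
proof -
  let ?B = "unit_ball X N"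
  define A where "A = {u \<in> ?B. \<forall>y\<in>X. \<forall>s\<ge>0. \<forall>\<epsilon>>0. \<exists>v\<in>?B.
     (\<forall>\<phi>\<in>H. \<bar>\<phi> (v - u)\<bar> < \<rho> / 2) \<and> N y + s - \<epsilon> \<le> N (y + s *\<^sub>R v)}"
  have "convex A"
  proof (rule convexI)
    fix u\<^sub>1 u\<^sub>2 and a b :: real
    assume u: "u\<^sub>1 \<in> A" "u\<^sub>2 \<in> A" and ab: "0 \<le> a" "0 \<le> b" "a + b = 1"
    have uB: "u\<^sub>1 \<in> ?B" "u\<^sub>2 \<in> ?B" using u by (auto simp: A_def)
    have "\<exists>v\<in>?B. (\<forall>\<phi>\<in>H. \<bar>\<phi> (v - (a *\<^sub>R u\<^sub>1 + b *\<^sub>R u\<^sub>2))\<bar> < \<rho> / 2) \<and> N y + s - \<epsilon> \<le> N (y + s *\<^sub>R v)"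
      if y: "y \<in> X" and s: "0 \<le> s" and \<epsilon>: "0 < \<epsilon>" for y s \<epsilon>
    proof -
      \<comment> \<open>Add \<open>s a v\<^sub>1\<close> to \<open>y\<close> first, and only then choose \<open>v\<^sub>2\<close>, for the vector obtained.\<close>
      have "0 \<le> s * a" "0 \<le> s * b" "0 < \<epsilon> / 2" using s ab \<epsilon> by auto
      then obtain v\<^sub>1 where v\<^sub>1: "v\<^sub>1 \<in> ?B" "\<forall>\<phi>\<in>H. \<bar>\<phi> (v\<^sub>1 - u\<^sub>1)\<bar> < \<rho> / 2"
          "N y + s * a - \<epsilon> / 2 \<le> N (y + (s * a) *\<^sub>R v\<^sub>1)"
        using u(1) y unfolding A_def by blast
      have "y + (s * a) *\<^sub>R v\<^sub>1 \<in> X" using y v\<^sub>1 by (auto simp: unit_ball_def)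
      with \<open>0 \<le> s * b\<close> \<open>0 < \<epsilon> / 2\<close> obtain v\<^sub>2 where v\<^sub>2: "v\<^sub>2 \<in> ?B" "\<forall>\<phi>\<in>H. \<bar>\<phi> (v\<^sub>2 - u\<^sub>2)\<bar> < \<rho> / 2"
          "N (y + (s * a) *\<^sub>R v\<^sub>1) + s * b - \<epsilon> / 2 \<le> N (y + (s * a) *\<^sub>R v\<^sub>1 + (s * b) *\<^sub>R v\<^sub>2)"
        using u(2) unfolding A_def by blast
      let ?v = "a *\<^sub>R v\<^sub>1 + b *\<^sub>R v\<^sub>2"
      have "?v \<in> ?B" using convexD[OF convex_unit_ball v\<^sub>1(1) v\<^sub>2(1) ab] .
      moreover have "\<bar>\<phi> (?v - (a *\<^sub>R u\<^sub>1 + b *\<^sub>R u\<^sub>2))\<bar> < \<rho> / 2" if "\<phi> \<in> H" for \<phi>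
      proof -
        have \<phi>: "\<phi> \<in> dual_space X N" using that H by blast
        have "?v - (a *\<^sub>R u\<^sub>1 + b *\<^sub>R u\<^sub>2) = a *\<^sub>R (v\<^sub>1 - u\<^sub>1) + b *\<^sub>R (v\<^sub>2 - u\<^sub>2)"
          by (simp add: algebra_simps)
        then have "\<phi> (?v - (a *\<^sub>R u\<^sub>1 + b *\<^sub>R u\<^sub>2)) = a * \<phi> (v\<^sub>1 - u\<^sub>1) + b * \<phi> (v\<^sub>2 - u\<^sub>2)"
          using v\<^sub>1(1) v\<^sub>2(1) uB by (simp add: dual_add[OF \<phi>] dual_scale[OF \<phi>] unit_ball_def)
        moreover have "a * \<phi> (v\<^sub>1 - u\<^sub>1) + b * \<phi> (v\<^sub>2 - u\<^sub>2) < \<rho> / 2"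
          using v\<^sub>1(2) v\<^sub>2(2) that ab by (intro convex_bound_lt) (auto simp: abs_less_iff)
        moreover have "a * (- \<phi> (v\<^sub>1 - u\<^sub>1)) + b * (- \<phi> (v\<^sub>2 - u\<^sub>2)) < \<rho> / 2"
          using v\<^sub>1(2) v\<^sub>2(2) that ab by (intro convex_bound_lt) (auto simp: abs_less_iff)
        ultimately show ?thesis by (auto simp only: abs_less_iff mult_minus_right minus_add_distrib)
      qed
      moreover have "N y + s - \<epsilon> \<le> N (y + s *\<^sub>R ?v)"
      proof -
        have "s * a + s * b = s" using ab by (metis distrib_left mult.right_neutral)
        then show ?thesis using v\<^sub>1(3) v\<^sub>2(3) by (simp add: scaleR_add_right add.assoc)
      qed
      ultimately show ?thesis by blast
    qed
    then show "a *\<^sub>R u\<^sub>1 + b *\<^sub>R u\<^sub>2 \<in> A"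
      using convexD[OF convex_unit_ball uB ab] by (auto simp: A_def)
  qed
  moreover have "\<exists>u\<in>A. \<alpha> < \<psi> u"
    if \<psi>: "\<psi> \<in> dual_space X N" and u\<^sub>0: "u\<^sub>0 \<in> ?B" "\<alpha> < \<psi> u\<^sub>0" for \<psi> \<alpha> u\<^sub>0
  proof -
    have "0 < \<rho> / 2" using \<rho> by simp
    then obtain w \<psi>' \<alpha>' where w: "w \<in> ?B" "\<psi>' \<in> dual_space X N" "\<alpha>' < \<psi>' w"
      and small: "\<And>u. u \<in> ?B \<Longrightarrow> \<alpha>' < \<psi>' u \<Longrightarrow> \<alpha> < \<psi> u \<and> (\<forall>\<phi>\<in>H. \<bar>\<phi> (u - w)\<bar> < \<rho> / 2)"
      using slice_contains_small_slice[OF \<psi> u\<^sub>0] by blast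
    have "w \<in> A"
      unfolding A_def using w(1) small daugavet_slice[OF dp X w(2,1,3)] by blast
    then show ?thesis using small w by blast
  qed
  ultimately obtain u where u: "u \<in> A" "\<forall>\<phi>\<in>H. \<bar>\<phi> (u - x)\<bar> < \<rho> / 2"
    using convex_meeting_slices_dense[of A x "\<rho> / 2"] x \<rho> A_def by auto
  have xX: "x \<in> X" using x by (simp add: unit_ball_def)
  obtain v where v: "v \<in> ?B" "\<forall>\<phi>\<in>H. \<bar>\<phi> (v - u)\<bar> < \<rho> / 2" "N (- x) + 1 - \<epsilon> \<le> N (- x + 1 *\<^sub>R v)"
    using u(1) carrier_closed(5)[OF xX] \<epsilon> zero_le_one unfolding A_def by blast
  have "\<bar>\<phi> (v - x)\<bar> < \<rho>" if "\<phi> \<in> H" for \<phi>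
  proof -
    have "\<phi> \<in> dual_space X N" using that H by blast
    then have "\<phi> (v - x) = \<phi> (v - u) + \<phi> (u - x)"
      using u(1) v(1) xX by (simp add: dual_diff A_def unit_ball_def)
    then show ?thesis using u(2) v(2) that by fastforce
  qed
  then show ?thesis using v xX by (intro bexI[of _ v]) (auto simp: N_minus)
qed

end

section \<open>Failure of the Point of Continuity Property\<close>

lemma weak_neighbourhood_basis:
  assumes "openin (weak_topology X N) V" "x \<in> V"
  shows "\<exists>H \<rho>. finite H \<and> H \<subseteq> dual_space X N \<and> 0 < \<rho> \<and> {u \<in> X. \<forall>\<phi>\<in>H. \<bar>\<phi> (u - x)\<bar> < \<rho>} \<subseteq> V"
proof -
  have "generate_topology_on {{x \<in> X. \<phi> x \<in> U} | \<phi> U. \<phi> \<in> dual_space X N \<and> open U} V"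
    using assms(1) by (simp add: weak_topology_def openin_topology_generated_by)
  then show ?thesis
    using assms(2)
  proof (induction V rule: generate_topology_on.induct)
    case (Int V W)
    then obtain G \<rho> where 1: "finite G" "G \<subseteq> dual_space X N" "0 < \<rho>" "{u \<in> X. \<forall>\<phi>\<in>G. \<bar>\<phi> (u - x)\<bar> < \<rho>} \<subseteq> V"
      by auto
    obtain H \<sigma> where 2: "finite H" "H \<subseteq> dual_space X N" "0 < \<sigma>" "{u \<in> X. \<forall>\<phi>\<in>H. \<bar>\<phi> (u - x)\<bar> < \<sigma>} \<subseteq> W"
      using Int by auto
    show ?case
      using 1 2 by (intro exI[of _ "G \<union> H"] exI[of _ "min \<rho> \<sigma>"]) (auto simp: subset_iff)
  next
    case (UN K)
    then show ?case by (meson Union_iff Union_upper order_trans)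
  next
    case (Basis V)
    then obtain \<phi> U where \<phi>: "V = {x \<in> X. \<phi> x \<in> U}" "\<phi> \<in> dual_space X N" "open U" by blast
    then obtain \<rho> where \<rho>: "0 < \<rho>" "\<And>t. \<bar>t - \<phi> x\<bar> < \<rho> \<Longrightarrow> t \<in> U"
      using Basis by (auto simp: open_dist dist_real_def)
    show ?case
      using \<phi> \<rho> Basis by (intro exI[of _ "{\<phi>}"] exI[of _ \<rho>]) (auto simp: dual_diff)
  qed auto
qed

text \<open>The unit ball is the set on which the identity has no point of continuity.\<close>

theorem daugavet_imp_not_PCP:
  assumes dp: "daugavet_property X N" and X: "X \<noteq> {0}"
  shows "\<not> point_of_continuity_property X N"
proof
  let ?B = "unit_ball X N"
  let ?S = "subtopology (weak_topology X N) ?B" and ?T = "subtopology (norm_topology X N) ?B"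
  assume "point_of_continuity_property X N"
  moreover have "?B \<subseteq> X \<and> ?B \<noteq> {} \<and> (\<exists>B. \<forall>x\<in>?B. N x \<le> B) \<and> closedin (norm_topology X N) ?B"
  proof -
    have "0 \<in> ?B" by (simp add: unit_ball_def)
    then show ?thesis using unit_ball_closedin by (auto simp: unit_ball_def)
  qed
  ultimately obtain x where "continuity_point ?S ?T (\<lambda>y. y) x"
    unfolding point_of_continuity_property_def by blast
  then have x: "x \<in> topspace ?S" "x \<in> ?B" and lim: "limitin ?T (\<lambda>y. y) x (atin ?S x)"
    by (auto simp: continuity_point_def)
  have xX: "x \<in> X" using x by (simp add: unit_ball_def)
  define U where "U = {u \<in> X. N (u - x) < 1 / 2} \<inter> ?B"
  have "openin ?T U"
    using openin_norm_ball[OF xX] unfolding U_def openin_subtopology by blast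
  moreover have "x \<in> U" using x xX by (simp add: U_def)
  ultimately have "\<forall>\<^sub>F y in atin ?S x. y \<in> U"
    using lim by (simp add: limitin_def)
  then obtain V where V: "openin ?S V" "x \<in> V" "\<forall>y\<in>V - {x}. y \<in> U"
    using x(1) by (auto simp: eventually_atin)
  then obtain W where W: "openin (weak_topology X N) W" "V = W \<inter> ?B"
    by (auto simp: openin_subtopology)
  then obtain H \<rho> where H: "finite H" "H \<subseteq> dual_space X N" "0 < \<rho>"
      "{u \<in> X. \<forall>\<phi>\<in>H. \<bar>\<phi> (u - x)\<bar> < \<rho>} \<subseteq> W"
    using weak_neighbourhood_basis[of W x] V(2) by blast
  obtain u where u: "u \<in> ?B" "\<forall>\<phi>\<in>H. \<bar>\<phi> (u - x)\<bar> < \<rho>" "N x + 1 - 1 / 2 \<le> N (u - x)"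
    using daugavet_weak_neighbourhood[OF H(1,2) dp X x(2) H(3), of "1/2"] by auto
  have "1 / 2 \<le> N (u - x)" using u(3) N_nonneg[OF xX] by simp
  moreover have "u \<in> V" using u H(4) W(2) by (auto simp: unit_ball_def)
  moreover have "u \<noteq> x" using \<open>1 / 2 \<le> N (u - x)\<close> by auto
  ultimately have "N (u - x) < 1 / 2" using V(3) by (auto simp: U_def)
  then show False using \<open>1 / 2 \<le> N (u - x)\<close> by simp
qed

section \<open>Closed subspaces of finite codimension\<close>

text \<open>If \<open>x\<close> is a limit of vectors \<open>c\<^sub>n e + z\<^sub>n\<close>, the coefficients are bounded, because the distance from
  \<open>e\<close> to \<open>Z\<close> is positive. A limit \<open>l\<close> of a subsequence puts \<open>x - l e\<close> into the closed
  subspace \<open>Z\<close>.\<close>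

lemma closed_subspace_add_vector:
  assumes Z: "subspace Z" "Z \<subseteq> X" "closedin (norm_topology X N) Z" and e: "e \<in> X"
  shows "closedin (norm_topology X N) (span (insert e Z))"
proof (cases "e \<in> Z")
  case True
  then show ?thesis using Z by (simp add: insert_absorb span_eq_iff[THEN iffD2])
next
  case False
  have far: "\<exists>r>0. \<forall>z\<in>Z. r \<le> N (x - z)" if "x \<in> X" "x \<notin> Z" for x
    using that Z(3) by (auto simp: closedin_norm_topology)
  have span: "span (insert e Z) = {c *\<^sub>R e + z | c z. z \<in> Z}"
    using Z(1) by (auto simp: span_insert span_eq_iff[THEN iffD2]) (metis add_diff_cancel_left' diff_add_cancel)+
  obtain r where r: "0 < r" "\<And>z. z \<in> Z \<Longrightarrow> r \<le> N (e - z)" using far[OF e False] by blast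
  have coef: "\<bar>c\<bar> * r \<le> N (c *\<^sub>R e + z)" if z: "z \<in> Z" for c z
  proof (cases "c = 0")
    case False
    have "r \<le> N (e - (- 1 / c) *\<^sub>R z)" using Z(1) z by (intro r(2)) (rule subspace_scale)
    then have "\<bar>c\<bar> * r \<le> N (c *\<^sub>R (e - (- 1 / c) *\<^sub>R z))"
      using e z Z(2) by (subst N_scale) (auto intro!: mult_left_mono)
    then show ?thesis using False by (simp add: scaleR_add_right)
  qed (use z Z(2) N_nonneg in auto)
  show ?thesis
    unfolding closedin_norm_topology
  proof (intro conjI ballI)
    show "span (insert e Z) \<subseteq> X" using e Z(2) by (auto simp: span)
    fix x assume x: "x \<in> X - span (insert e Z)"
    show "\<exists>r>0. \<forall>v\<in>span (insert e Z). r \<le> N (x - v)"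
    proof (rule ccontr)
      assume "\<not> ?thesis"
      then have "\<exists>c z. z \<in> Z \<and> N (x - (c *\<^sub>R e + z)) < 1 / real (Suc n)" for n
        by (fastforce simp: span not_le dest: spec[of _ "1 / real (Suc n)"])
      then obtain c z where z: "\<And>n. z n \<in> Z" and lt: "\<And>n. N (x - (c n *\<^sub>R e + z n)) < 1 / real (Suc n)"
        by metis
      have zX: "z n \<in> X" for n using z Z(2) by blast
      have "\<bar>c n\<bar> \<le> (N x + 1) / r" for n
      proof -
        have "\<bar>c n\<bar> * r \<le> N (x - (x - (c n *\<^sub>R e + z n)))" using coef[OF z] by (simp add: add.commute)
        also have "\<dots> \<le> N x + N (x - (c n *\<^sub>R e + z n))" using x e zX by (intro N_diff_le) auto
        also have "\<dots> \<le> N x + 1"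
          using lt[of n] by (simp add: field_simps) (smt (verit) of_nat_0_le_iff mult_nonneg_nonneg)
        finally show ?thesis using r(1) by (simp add: field_simps)
      qed
      then have "bounded (range c)" by (auto simp: bounded_iff)
      then obtain l s where s: "strict_mono s" "(c \<circ> s) \<longlonglongrightarrow> l"
        using bounded_imp_convergent_subsequence by blast
      have "x - l *\<^sub>R e \<in> X" using x e by auto
      moreover have "x - l *\<^sub>R e \<notin> Z"
      proof
        assume "x - l *\<^sub>R e \<in> Z"
        then have "l *\<^sub>R e + (x - l *\<^sub>R e) \<in> span (insert e Z)" unfolding span by blast
        then show False using x by simp
      qed
      ultimately obtain d where d: "0 < d" "\<And>z. z \<in> Z \<Longrightarrow> d \<le> N (x - l *\<^sub>R e - z)" using far by blast
      have "d \<le> 1 / real (Suc (s n)) + \<bar>c (s n) - l\<bar> * N e" for n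
      proof -
        have "d \<le> N ((x - (c (s n) *\<^sub>R e + z (s n))) + (c (s n) - l) *\<^sub>R e)"
          using d(2)[OF z[of "s n"]] by (simp add: algebra_simps)
        also have "\<dots> \<le> N (x - (c (s n) *\<^sub>R e + z (s n))) + \<bar>c (s n) - l\<bar> * N e"
          using N_triangle[of "x - (c (s n) *\<^sub>R e + z (s n))" "(c (s n) - l) *\<^sub>R e"] x e zX
          by (simp add: N_scale)
        finally show ?thesis using lt[of "s n"] by simp
      qed
      moreover have "(\<lambda>n. 1 / real (Suc (s n)) + \<bar>c (s n) - l\<bar> * N e) \<longlonglongrightarrow> 0 + 0 * N e"
      proof (intro tendsto_intros)
        show "(\<lambda>n. 1 / real (Suc (s n))) \<longlonglongrightarrow> 0"
          using LIMSEQ_subseq_LIMSEQ[OF LIMSEQ_inverse_real_of_nat s(1)] by (simp add: o_def field_simps)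
        show "(\<lambda>n. \<bar>c (s n) - l\<bar>) \<longlonglongrightarrow> 0"
          using s(2) by (simp add: o_def LIM_zero_iff tendsto_rabs_zero_iff)
      qed
      ultimately have "d \<le> 0 + 0 * N e" by (intro LIMSEQ_le_const) auto
      then show False using d(1) by simp
    qed
  qed
qed

lemma closed_subspace_add_finite:
  assumes Z: "subspace Z" "Z \<subseteq> X" "closedin (norm_topology X N) Z" and F: "finite F" "F \<subseteq> X"
  shows "closedin (norm_topology X N) (span (Z \<union> F))"
  using F
proof (induction F rule: finite_induct)
  case empty
  then show ?case using Z by (simp add: span_eq_iff[THEN iffD2])
next
  case (insert e F)
  have "span (Z \<union> F) \<subseteq> X" using Z(2) insert subspace_carrier by (intro span_minimal) auto
  then have "closedin (norm_topology X N) (span (insert e (span (Z \<union> F))))"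
    using insert by (intro closed_subspace_add_vector) auto
  also have "span (insert e (span (Z \<union> F))) = span (Z \<union> insert e F)"
    by (simp add: span_insert span_span)
  finally show ?case .
qed

text \<open>The coordinate along a complement of a closed hyperplane \<open>Y\<close> is bounded by the reciprocal of the
  distance from \<open>e\<close> to \<open>Y\<close>.\<close>

lemma coordinate_functional:
  assumes Y: "subspace Y" "Y \<subseteq> X" "closedin (norm_topology X N) Y" and e: "e \<in> X" "e \<notin> Y"
    and X: "X \<subseteq> span (insert e Y)"
  shows "\<exists>\<phi>\<in>dual_space X N. \<forall>x\<in>X. \<forall>c. x - c *\<^sub>R e \<in> Y \<longleftrightarrow> c = \<phi> x"
proof -
  have "\<exists>c. x - c *\<^sub>R e \<in> Y" if "x \<in> X" for x
    using X that Y(1) by (auto simp: span_insert span_eq_iff[THEN iffD2])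
  then obtain \<phi> where \<phi>: "\<And>x. x \<in> X \<Longrightarrow> x - \<phi> x *\<^sub>R e \<in> Y" by metis
  have uniq: "\<phi> x = c" if "x \<in> X" "x - c *\<^sub>R e \<in> Y" for x c
  proof (rule ccontr)
    assume "\<phi> x \<noteq> c"
    have "(1 / (\<phi> x - c)) *\<^sub>R ((x - c *\<^sub>R e) - (x - \<phi> x *\<^sub>R e)) \<in> Y"
      by (rule subspace_scale[OF Y(1)], rule subspace_diff[OF Y(1) that(2) \<phi>[OF that(1)]])
    also have "(x - c *\<^sub>R e) - (x - \<phi> x *\<^sub>R e) = (\<phi> x - c) *\<^sub>R e" by (simp add: algebra_simps)
    finally show False using \<open>\<phi> x \<noteq> c\<close> e by simp
  qed
  have "is_linear_on X \<phi>"
    unfolding is_linear_on_def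
  proof (intro conjI ballI allI)
    fix x y assume xy: "x \<in> X" "y \<in> X"
    have "(x - \<phi> x *\<^sub>R e) + (y - \<phi> y *\<^sub>R e) \<in> Y" using \<phi> xy Y(1) by (intro subspace_add) auto
    then show "\<phi> (x + y) = \<phi> x + \<phi> y" using xy by (intro uniq) (auto simp: algebra_simps)
  next
    fix x c assume x: "x \<in> X"
    have "c *\<^sub>R (x - \<phi> x *\<^sub>R e) \<in> Y" using \<phi> x Y(1) by (intro subspace_scale) auto
    then show "\<phi> (c *\<^sub>R x) = c *\<^sub>R \<phi> x" using x by (intro uniq) (auto simp: algebra_simps)
  qed
  moreover obtain r where r: "0 < r" "\<And>y. y \<in> Y \<Longrightarrow> r \<le> N (e - y)"
    using Y(3) e unfolding closedin_norm_topology by blast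
  have "\<bar>\<phi> x\<bar> \<le> (1 / r) * N x" if x: "x \<in> X" for x
  proof (cases "\<phi> x = 0")
    case False
    have "r \<le> N (e - (- 1 / \<phi> x) *\<^sub>R (x - \<phi> x *\<^sub>R e))"
      using \<phi>[OF x] Y(1) by (intro r(2)) (rule subspace_scale)
    also have "e - (- 1 / \<phi> x) *\<^sub>R (x - \<phi> x *\<^sub>R e) = (1 / \<phi> x) *\<^sub>R x"
      using False by (simp add: algebra_simps)
    also have "N \<dots> = N x / \<bar>\<phi> x\<bar>" using x by (simp add: N_scale)
    finally show ?thesis using False r(1) by (simp add: field_simps)
  qed (use x r N_nonneg in auto)
  ultimately have "\<phi> \<in> dual_space X N" unfolding dual_space_def by blast
  then show ?thesis using \<phi> uniq by blast
qed

text \<open>With a complementary family \<open>F\<close> of least cardinality, the coordinates along \<open>F\<close> are bounded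
  functionals, and subtracting the part of \<open>x\<close> in the span of \<open>F\<close> leaves an element of \<open>Z\<close>.\<close>

lemma cof_weak_neighbourhood:
  assumes Z: "Z \<in> cof X N" and \<epsilon>: "0 < \<epsilon>"
  obtains H \<rho> where "finite H" "H \<subseteq> dual_space X N" "0 < \<rho>"
    "\<And>x. x \<in> X \<Longrightarrow> \<forall>\<phi>\<in>H. \<bar>\<phi> x\<bar> < \<rho> \<Longrightarrow> \<exists>z\<in>Z. N (x - z) \<le> \<epsilon>"
proof -
  have Zs: "subspace Z" "Z \<subseteq> X" "closedin (norm_topology X N) Z"
    using Z by (auto simp: cof_def)
  define P where "P F \<longleftrightarrow> finite F \<and> span (Z \<union> F) = X" for F
  have "\<exists>F. P F" using Z by (auto simp: cof_def P_def)
  then obtain F where F: "P F" "\<And>F'. P F' \<Longrightarrow> card F \<le> card F'"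
    by (metis ex_has_least_nat)
  have fin: "finite F" and X: "span (Z \<union> F) = X" and FX: "F \<subseteq> X"
    using F(1) span_superset[of "Z \<union> F"] by (auto simp: P_def)
  have "\<exists>\<phi>\<in>dual_space X N. \<forall>x\<in>X. \<forall>c. x - c *\<^sub>R e \<in> span (Z \<union> (F - {e})) \<longleftrightarrow> c = \<phi> x" if e: "e \<in> F" for e
  proof (rule coordinate_functional)
    let ?Y = "span (Z \<union> (F - {e}))"
    show "?Y \<subseteq> X" using X by (metis Diff_subset Un_mono order_refl span_mono)
    show "closedin (norm_topology X N) ?Y" using Zs fin FX by (intro closed_subspace_add_finite) auto
    show "e \<in> X" using e FX by blast
    have eq: "insert e (Z \<union> (F - {e})) = Z \<union> F" using e by blast
    show "e \<notin> ?Y"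
    proof
      assume "e \<in> ?Y"
      then have "P (F - {e})" using fin X eq by (metis P_def finite_Diff span_redundant)
      then show False using F(2) fin e by (meson card_Diff1_less not_le)
    qed
    have "Z \<union> F \<subseteq> insert e ?Y" using eq span_superset by blast
    then show "X \<subseteq> span (insert e ?Y)" using X span_mono by blast
  qed auto
  then obtain \<phi> where \<phi>: "\<And>e. e \<in> F \<Longrightarrow> \<phi> e \<in> dual_space X N"
      "\<And>e x c. e \<in> F \<Longrightarrow> x \<in> X \<Longrightarrow> x - c *\<^sub>R e \<in> span (Z \<union> (F - {e})) \<Longrightarrow> c = \<phi> e x"
    by metis
  have decomp: "x - (\<Sum>e\<in>F. \<phi> e x *\<^sub>R e) \<in> Z" if x: "x \<in> X" for x
  proof -
    obtain z f where zf: "z \<in> Z" "f \<in> span F" "x = z + f"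
      using x Zs(1) unfolding X[symmetric] by (auto simp: span_Un span_eq_iff[THEN iffD2])
    obtain a where a: "f = (\<Sum>e\<in>F. a e *\<^sub>R e)" using zf(2) fin by (auto simp: span_finite)
    have "a e = \<phi> e x" if e: "e \<in> F" for e
    proof (rule \<phi>(2)[OF e x])
      have "x - a e *\<^sub>R e = z + (\<Sum>e\<in>F - {e}. a e *\<^sub>R e)"
        using fin e by (simp add: zf a sum.remove)
      then show "x - a e *\<^sub>R e \<in> span (Z \<union> (F - {e}))"
        using zf(1) by (auto intro!: span_add span_sum span_scale intro: span_base)
    qed
    then have "(\<Sum>e\<in>F. \<phi> e x *\<^sub>R e) = f" unfolding a by (intro sum.cong) auto
    then show ?thesis using zf by simp
  qed
  define S where "S = 1 + (\<Sum>e\<in>F. N e)"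
  have S: "0 < S" "(\<Sum>e\<in>F. N e) \<le> S"
    using sum_nonneg[of F N] FX N_nonneg by (auto simp: S_def subset_iff)
  show ?thesis
  proof (rule that[of "\<phi> ` F" "\<epsilon> / S"])
    fix x assume x: "x \<in> X" "\<forall>\<psi>\<in>\<phi> ` F. \<bar>\<psi> x\<bar> < \<epsilon> / S"
    have "N (\<Sum>e\<in>F. \<phi> e x *\<^sub>R e) \<le> (\<Sum>e\<in>F. N (\<phi> e x *\<^sub>R e))"
      using fin FX by (intro N_sum_le) auto
    also have "\<dots> \<le> (\<Sum>e\<in>F. \<epsilon> / S * N e)"
    proof (rule sum_mono)
      fix e assume e: "e \<in> F"
      have "\<bar>\<phi> e x\<bar> * N e \<le> \<epsilon> / S * N e"
        using e x(2) FX N_nonneg[of e] by (intro mult_right_mono) (auto simp: less_imp_le)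
      then show "N (\<phi> e x *\<^sub>R e) \<le> \<epsilon> / S * N e" using e FX by (simp add: N_scale subset_iff)
    qed
    also have "\<dots> = \<epsilon> / S * (\<Sum>e\<in>F. N e)" by (simp add: sum_distrib_left)
    also have "\<dots> \<le> \<epsilon> / S * S" using S \<epsilon> by (intro mult_left_mono) auto
    also have "\<dots> = \<epsilon>" using S by simp
    finally show "\<exists>z\<in>Z. N (x - z) \<le> \<epsilon>" using decomp[OF x(1)]
      by (intro bexI[of _ "x - (\<Sum>e\<in>F. \<phi> e x *\<^sub>R e)"]) simp_all
  qed (use fin \<phi> S \<epsilon> in auto)
qed

lemma kernel_in_cof:
  assumes "finite H" "H \<subseteq> dual_space X N"
  shows "{x \<in> X. \<forall>\<phi>\<in>H. \<phi> x = 0} \<in> cof X N"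
proof -
  let ?K = "\<lambda>H. {x \<in> X. \<forall>\<phi>\<in>H. \<phi> x = 0}"
  have sub: "subspace (?K H)" if "H \<subseteq> dual_space X N" for H
  proof (rule subspaceI)
    have "\<phi> 0 = 0" if "\<phi> \<in> H" for \<phi>
      using dual_scale[of \<phi> 0 0] that \<open>H \<subseteq> dual_space X N\<close> by auto
    then show "0 \<in> ?K H" by simp
  qed (use that in \<open>auto simp: dual_add dual_scale subset_iff\<close>)
  have "closedin (norm_topology X N) (?K H)"
    unfolding closedin_norm_topology
  proof (intro conjI ballI)
    fix x assume "x \<in> X - ?K H"
    then obtain \<phi> where \<phi>: "\<phi> \<in> H" "\<phi> x \<noteq> 0" and x: "x \<in> X" by blast
    have \<phi>d: "\<phi> \<in> dual_space X N" using \<phi> assms by blast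
    then obtain B where B: "0 \<le> B" "\<And>x. x \<in> X \<Longrightarrow> \<bar>\<phi> x\<bar> \<le> B * N x" using dual_bound by metis
    have "\<bar>\<phi> x\<bar> / (B + 1) \<le> N (x - z)" if z: "z \<in> ?K H" for z
    proof -
      have "\<phi> z = 0" using z \<phi>(1) by simp
      moreover have "z \<in> X" using z by blast
      ultimately have "\<bar>\<phi> x\<bar> = \<bar>\<phi> (x - z)\<bar>" using dual_diff[OF \<phi>d x, of z] by (metis diff_zero)
      also have "\<dots> \<le> B * N (x - z)" using B(2) x z by simp
      also have "\<dots> \<le> (B + 1) * N (x - z)" using x z N_nonneg[of "x - z"] by (simp add: algebra_simps)
      finally show ?thesis using B(1) by (simp add: field_simps)
    qed
    then show "\<exists>r>0. \<forall>z\<in>?K H. r \<le> N (x - z)"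
      using \<phi>(2) B(1) by (intro exI[of _ "\<bar>\<phi> x\<bar> / (B + 1)"]) auto
  qed auto
  moreover have "\<exists>F. finite F \<and> F \<subseteq> X \<and> X \<subseteq> span (?K H \<union> F)"
    using assms
  proof (induction H rule: finite_induct)
    case empty
    then show ?case by (intro exI[of _ "{}"]) (auto intro: span_base)
  next
    case (insert \<phi> H)
    then obtain F where F: "finite F" "F \<subseteq> X" "X \<subseteq> span (?K H \<union> F)" by auto
    have \<phi>: "\<phi> \<in> dual_space X N" using insert by simp
    show ?case
    proof (cases "\<forall>x\<in>?K H. \<phi> x = 0")
      case True
      then have eq: "?K (insert \<phi> H) = ?K H" by auto
      show ?thesis unfolding eq using F by (intro exI[of _ F] conjI)
    next
      case False
      then obtain e where e: "e \<in> ?K H" "\<phi> e \<noteq> 0" by blast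
      have subH: "subspace (?K H)" using insert.prems by (intro sub) simp
      let ?V = "span (?K (insert \<phi> H) \<union> insert e F)"
      have "x \<in> ?V" if x: "x \<in> ?K H" for x
      proof -
        have "x - (\<phi> x / \<phi> e) *\<^sub>R e \<in> ?K H"
          by (rule subspace_diff[OF subH x subspace_scale[OF subH e(1)]])
        then have "x - (\<phi> x / \<phi> e) *\<^sub>R e \<in> ?K (insert \<phi> H)"
          using x e \<phi> by (auto simp: dual_diff dual_scale)
        then have "(x - (\<phi> x / \<phi> e) *\<^sub>R e) + (\<phi> x / \<phi> e) *\<^sub>R e \<in> ?V"
          by (intro span_add span_scale) (auto intro: span_base)
        then show ?thesis by simp
      qed
      then have "?K H \<union> F \<subseteq> ?V" by (auto intro: span_base)
      then have "X \<subseteq> ?V" using F(3) span_minimal[OF _ subspace_span] by blast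
      then show ?thesis using F e by (intro exI[of _ "insert e F"]) auto
    qed
  qed
  then obtain F where F: "finite F" "F \<subseteq> X" "X \<subseteq> span (?K H \<union> F)" by blast
  moreover have "span (?K H \<union> F) \<subseteq> X" using F(2) subspace_carrier by (intro span_minimal) auto
  ultimately have "finite F \<and> span (?K H \<union> F) = X" by simp
  then show ?thesis
    using \<open>closedin _ _\<close> sub[OF assms(2)] unfolding cof_def by (intro CollectI conjI exI[of _ F]) auto
qed

section \<open>Asymptotically uniformly convex renormings\<close>

text \<open>The modulus speaks of increments of norm exactly \<open>t\<close>. Longer increments are covered by convexity of
  the norm along the segment from \<open>x\<close> to \<open>x + z\<close>.\<close>

lemma asymp_uniformly_convex_growth:
  assumes auc: "asymp_uniformly_convex X N" and t: "0 < t"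
  obtains \<delta> where "0 < \<delta>"
    "\<And>x. x \<in> X \<Longrightarrow> N x = 1 \<Longrightarrow>
       \<exists>Z\<in>cof X N. \<forall>z\<in>Z. t \<le> N z \<longrightarrow> 1 + \<delta> \<le> N (x + z)"
proof -
  have "0 < auc_modulus X N t" using auc t by (simp add: asymp_uniformly_convex_def)
  then obtain d where d: "0 < ereal d" "ereal d < auc_modulus X N t"
    using ereal_dense2 by blast
  show ?thesis
  proof (rule that[of d])
    show "0 < d" using d by simp
    fix x assume x: "x \<in> X" "N x = 1"
    have "ereal d < (SUP Z\<in>cof X N. INF z\<in>unit_sphere Z N. ereal (N (x + t *\<^sub>R z) - 1))"
      using d(2) x unfolding auc_modulus_def
      by (rule_tac less_le_trans[OF _ INF_lower]) (auto simp: unit_sphere_def)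
    then obtain Z where Z: "Z \<in> cof X N" "ereal d < (INF z\<in>unit_sphere Z N. ereal (N (x + t *\<^sub>R z) - 1))"
      by (auto simp: less_SUP_iff)
    have Zs: "subspace Z" "Z \<subseteq> X" using Z by (auto simp: cof_def)
    have 1: "1 + d \<le> N (x + t *\<^sub>R z)" if "z \<in> Z" "N z = 1" for z
    proof -
      have "ereal d \<le> ereal (N (x + t *\<^sub>R z) - 1)"
        using that by (intro order_trans[OF less_imp_le[OF Z(2)] INF_lower]) (auto simp: unit_sphere_def)
      then show ?thesis by simp
    qed
    have "1 + d \<le> N (x + z)" if z: "z \<in> Z" "t \<le> N z" for z
    proof -
      define s where "s = t / N z"
      have s: "0 < s" "s \<le> 1" using z t by (auto simp: s_def)
      have zX: "z \<in> X" using z Zs by blast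
      have "1 + d \<le> N (x + t *\<^sub>R ((1 / N z) *\<^sub>R z))"
        using z t Zs zX by (intro 1) (auto simp: N_scale subspace_scale)
      also have "x + t *\<^sub>R ((1 / N z) *\<^sub>R z) = (1 - s) *\<^sub>R x + s *\<^sub>R (x + z)"
        by (simp add: s_def algebra_simps)
      also have "N \<dots> \<le> (1 - s) * N x + s * N (x + z)"
        using N_triangle[of "(1 - s) *\<^sub>R x" "s *\<^sub>R (x + z)"] x zX s by (simp add: N_scale)
      finally have "d + s \<le> s * N (x + z)" using x by simp
      moreover have "s * (1 + d) \<le> d + s" using s \<open>0 < d\<close> by (simp add: algebra_simps mult_left_le_one_le)
      ultimately have "s * (1 + d) \<le> s * N (x + z)" by linarith
      then show ?thesis using s by simp
    qed
    then show "\<exists>Z\<in>cof X N. \<forall>z\<in>Z. t \<le> N z \<longrightarrow> 1 + d \<le> N (x + z)" using Z by blast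
  qed
qed

text \<open>A small weak neighbourhood of an almost \<open>N'\<close>-maximal point \<open>x\<close> of the \<open>N\<close>-ball would have
  small diameter, against \<open>daugavet_weak_neighbourhood\<close>.\<close>

theorem daugavet_imp_not_AUC_renorming:
  assumes dp: "daugavet_property X N" and X: "X \<noteq> {0}" and eq: "equivalent_norm X N N'"
  shows "\<not> asymp_uniformly_convex X N'"
proof
  assume auc: "asymp_uniformly_convex X N'"
  interpret N': normed_subspace X N'
    using eq subspace_carrier by unfold_locales (auto simp: equivalent_norm_def)
  obtain a b where ab: "0 < a" "0 < b" "\<And>x. x \<in> X \<Longrightarrow> a * N x \<le> N' x" "\<And>x. x \<in> X \<Longrightarrow> N' x \<le> b * N x"
    using eq by (auto simp: equivalent_norm_def)
  have dual: "dual_space X N' \<subseteq> dual_space X N"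
  proof
    fix \<phi> assume \<phi>: "\<phi> \<in> dual_space X N'"
    then obtain B where B: "0 \<le> B" "\<And>x. x \<in> X \<Longrightarrow> \<bar>\<phi> x\<bar> \<le> B * N' x" using N'.dual_bound by metis
    have "\<bar>\<phi> x\<bar> \<le> (B * b) * N x" if "x \<in> X" for x
      using B(2)[OF that] mult_left_mono[OF ab(4)[OF that] B(1)] by (simp add: mult.assoc)
    then show "\<phi> \<in> dual_space X N" using \<phi> by (auto simp: dual_space_def)
  qed
  let ?B = "unit_ball X N"
  define R where "R = (SUP x\<in>?B. N' x)"
  have bdd: "bdd_above (N' ` ?B)"
  proof (rule bdd_aboveI2)
    fix x assume "x \<in> ?B"
    then show "N' x \<le> b * 1" using ab(2) ab(4)[of x] by (auto simp: unit_ball_def intro: order_trans)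
  qed
  have R: "N' x \<le> R" if "x \<in> ?B" for x
    unfolding R_def using that bdd by (rule cSUP_upper)
  obtain y where y: "y \<in> X" "N y = 1" using unit_vector_exists[OF X carrier_closed(1)] by metis
  have "0 < R" using R[of y] ab(1) ab(3)[of y] y by (simp add: unit_ball_def)
  \<comment> \<open>The points \<open>u\<close> below satisfy \<open>N (u - x) \<ge> 1 / 2\<close>. Hence the part of \<open>u - x\<close> in the subspace has \<open>N'\<close>-norm at least \<open>a / 4\<close>, also after the error \<open>\<epsilon> \<le> a / 4\<close>, and at least \<open>t\<close> after division by \<open>N' x \<le> R\<close>.\<close>
  define t where "t = a / (4 * R)"
  have "0 < t" using ab \<open>0 < R\<close> by (simp add: t_def)
  then obtain \<delta> where \<delta>: "0 < \<delta>"
      "\<And>x. x \<in> X \<Longrightarrow> N' x = 1 \<Longrightarrow> \<exists>Z\<in>cof X N'. \<forall>z\<in>Z. t \<le> N' z \<longrightarrow> 1 + \<delta> \<le> N' (x + z)"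
    using N'.asymp_uniformly_convex_growth[OF auc] by metis
  have "R / (1 + \<delta>) < R" using \<delta> \<open>0 < R\<close> by (simp add: field_simps)
  then obtain x where x: "x \<in> ?B" "R / (1 + \<delta>) < N' x"
    unfolding R_def using bdd y by (subst (asm) less_cSUP_iff) (auto simp: unit_ball_def)
  have xX: "x \<in> X" using x by (simp add: unit_ball_def)
  have "0 < R / (1 + \<delta>)" using \<delta>(1) \<open>0 < R\<close> by simp
  then have Nx: "0 < N' x" "R < N' x * (1 + \<delta>)"
    using x(2) \<delta>(1) by (linarith, simp add: pos_divide_less_eq)
  obtain Z where Z: "Z \<in> cof X N'"
      "\<And>z. z \<in> Z \<Longrightarrow> t \<le> N' z \<Longrightarrow> 1 + \<delta> \<le> N' ((1 / N' x) *\<^sub>R x + z)"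
    using \<delta>(2)[of "(1 / N' x) *\<^sub>R x"] xX Nx by (auto simp: N'.N_scale)
  have Zs: "subspace Z" "Z \<subseteq> X" using Z(1) by (auto simp: cof_def)
  define \<epsilon> where "\<epsilon> = min (a / 4) ((N' x * (1 + \<delta>) - R) / 2)"
  have \<epsilon>: "0 < \<epsilon>" "\<epsilon> \<le> a / 4" "\<epsilon> < N' x * (1 + \<delta>) - R"
    using Nx ab by (auto simp: \<epsilon>_def min_def)
  obtain H \<rho> where H: "finite H" "H \<subseteq> dual_space X N'" "0 < \<rho>"
      "\<And>x. x \<in> X \<Longrightarrow> \<forall>\<phi>\<in>H. \<bar>\<phi> x\<bar> < \<rho> \<Longrightarrow> \<exists>z\<in>Z. N' (x - z) \<le> \<epsilon>"
    using N'.cof_weak_neighbourhood[OF Z(1) \<epsilon>(1)] by metis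
  obtain u where u: "u \<in> ?B" "\<forall>\<phi>\<in>H. \<bar>\<phi> (u - x)\<bar> < \<rho>" "N x + 1 - 1 / 2 \<le> N (u - x)"
    using daugavet_weak_neighbourhood[of H x \<rho> "1/2"] H dual dp X x(1) by auto
  have uX: "u \<in> X" using u by (simp add: unit_ball_def)
  obtain z where z: "z \<in> Z" "N' ((u - x) - z) \<le> \<epsilon>" using H(4)[of "u - x"] u(2) uX xX by auto
  have zX: "z \<in> X" using z Zs by blast
  have "a / 4 \<le> N' z"
  proof -
    have "a * (1 / 2) \<le> a * N (u - x)"
      using u(3) N_nonneg[OF xX] ab(1) by (intro mult_left_mono) auto
    also have "\<dots> \<le> N' (u - x)" using ab(3) uX xX by simp
    also have "\<dots> \<le> N' z + \<epsilon>"
      using N'.N_triangle[of "u - x - z" z] z(2) uX xX zX by simp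
    finally show ?thesis using \<epsilon>(2) by simp
  qed
  then have "t \<le> N' ((1 / N' x) *\<^sub>R z)"
  proof -
    have "a / 4 / R \<le> N' z / N' x"
      using \<open>a / 4 \<le> N' z\<close> R[OF x(1)] Nx(1) ab by (intro frac_le) auto
    then show ?thesis using zX Nx by (simp add: t_def N'.N_scale)
  qed
  then have "1 + \<delta> \<le> N' ((1 / N' x) *\<^sub>R x + (1 / N' x) *\<^sub>R z)"
    using z Zs by (intro Z(2) subspace_scale)
  also have "\<dots> = N' (x + z) / N' x"
    using Nx N'.N_scale[of "x + z" "1 / N' x"] xX zX by (simp add: scaleR_add_right)
  finally have "N' x * (1 + \<delta>) \<le> N' (x + z)" using Nx(1) by (simp add: field_simps)
  also have "\<dots> = N' (u - (u - x - z))" by (simp add: algebra_simps)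
  also have "\<dots> \<le> R + \<epsilon>"
    using N'.N_diff_le[of u "u - x - z"] R[OF u(1)] z(2) uX xX zX by simp
  finally show False using \<epsilon>(3) by simp
qed

end

section \<open>Relative compactness in measure and midpoint convexity\<close>

text \<open>Absolute continuity of the integral: truncating \<open>\<bar>f\<bar>\<close> at a large height \<open>n\<close> changes the integral
  little, and the truncation contributes at most \<open>n\<close> times the measure of the set.\<close>

lemma (in finite_measure) integral_small_on_small_sets:
  fixes f :: "'a \<Rightarrow> real"
  assumes f: "integrable M f" and e: "0 < e"
  shows "\<exists>d>0. \<forall>A\<in>sets M. measure M A < d \<longrightarrow> (LINT x|M. \<bar>f x\<bar> * indicator A x) \<le> e"
proof -
  have [measurable]: "f \<in> borel_measurable M" using f by simp
  have "(\<lambda>n. LINT x|M. \<bar>f x\<bar> - min \<bar>f x\<bar> (real n)) \<longlonglongrightarrow> (LINT x|M. 0)"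
  proof (rule integral_dominated_convergence[where w = "\<lambda>x. \<bar>f x\<bar>"])
    show "AE x in M. (\<lambda>n. \<bar>f x\<bar> - min \<bar>f x\<bar> (real n)) \<longlonglongrightarrow> 0"
    proof (rule AE_I2, rule tendsto_eventually)
      fix x
      obtain n\<^sub>0 where "\<bar>f x\<bar> \<le> real n\<^sub>0" using real_arch_simple by blast
      then show "\<forall>\<^sub>F n in sequentially. \<bar>f x\<bar> - min \<bar>f x\<bar> (real n) = 0"
        by (intro eventually_sequentiallyI[of n\<^sub>0]) (auto simp: min_def)
    qed
  qed (use f in auto)
  then have "\<forall>\<^sub>F n in sequentially. (LINT x|M. \<bar>f x\<bar> - min \<bar>f x\<bar> (real n)) < e / 2"
    using e by (intro order_tendstoD(2)[where y = 0]) auto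
  then obtain n where n: "(LINT x|M. \<bar>f x\<bar> - min \<bar>f x\<bar> (real n)) < e / 2"
    by (auto simp: eventually_sequentially)
  have int: "integrable M (\<lambda>x. \<bar>f x\<bar> - min \<bar>f x\<bar> (real n))"
    by (rule Bochner_Integration.integrable_bound[OF integrable_abs[OF f]]) auto
  show ?thesis
  proof (intro exI[of _ "e / (2 * (real n + 1))"] conjI ballI impI)
    show "0 < e / (2 * (real n + 1))" using e by simp
    fix A assume A: "A \<in> sets M" "measure M A < e / (2 * (real n + 1))"
    have ind: "integrable M (indicat_real A)" using A by (simp add: emeasure_eq_measure)
    have "(LINT x|M. \<bar>f x\<bar> * indicator A x)
        \<le> (LINT x|M. (\<bar>f x\<bar> - min \<bar>f x\<bar> (real n)) + real n * indicator A x)"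
    proof (rule integral_mono)
      show "integrable M (\<lambda>x. \<bar>f x\<bar> * indicator A x)"
        using integrable_real_mult_indicator[OF A(1) integrable_abs[OF f]] by (simp add: mult.commute)
      show "integrable M (\<lambda>x. (\<bar>f x\<bar> - min \<bar>f x\<bar> (real n)) + real n * indicator A x)"
        using int ind by simp
    qed (auto simp: indicator_def)
    also have "\<dots> = (LINT x|M. \<bar>f x\<bar> - min \<bar>f x\<bar> (real n)) + real n * measure M A"
      using int ind A(1) sets.sets_into_space[OF A(1)] by (simp add: Int_absorb2)
    also have "real n * measure M A \<le> (real n + 1) * (e / (2 * (real n + 1)))"
      using A by (intro mult_mono) auto
    also have "(real n + 1) * (e / (2 * (real n + 1))) = e / 2" by (simp add: field_simps)
    finally show "(LINT x|M. \<bar>f x\<bar> * indicator A x) \<le> e" using n by simp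
  qed
qed

text \<open>On the set \<open>A\<close> where \<open>z\<close> deviates from \<open>f\<close>, the sum of \<open>\<bar>x + t z\<bar>\<close> and \<open>\<bar>x - t z\<bar>\<close> is estimated
  by \<open>2 t \<bar>z\<bar>\<close>, and elsewhere by \<open>2 \<bar>x\<bar>\<close>. Off \<open>A\<close>, \<open>z sgn f\<close> is at least \<open>\<bar>z\<bar> - 2 \<eta>\<close>, so the
  vanishing of its integral forces about half of the mass of \<open>z\<close> onto \<open>A\<close>. As \<open>f\<close>
  enters through its sign and through \<open>A\<close> only, it may be any point of \<open>L\<^sub>0\<close>, as the centres of a
  cover in measure are.\<close>

lemma (in finite_measure) midpoint_estimate:
  fixes x z f :: "'a \<Rightarrow> real"
  assumes x: "integrable M x" and z: "integrable M z" and f: "f \<in> borel_measurable M"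
    and orth: "(LINT \<omega>|M. z \<omega> * sgn (f \<omega>)) = 0" and t: "0 \<le> t" and \<eta>: "0 \<le> \<eta>"
  defines "A \<equiv> {\<omega> \<in> space M. \<eta> \<le> \<bar>z \<omega> - f \<omega>\<bar>}"
  shows "2 * (LINT \<omega>|M. \<bar>x \<omega>\<bar>) - 2 * (LINT \<omega>|M. \<bar>x \<omega>\<bar> * indicator A \<omega>)
      + t * ((LINT \<omega>|M. \<bar>z \<omega>\<bar>) - 2 * \<eta> * measure M (space M))
    \<le> (LINT \<omega>|M. \<bar>x \<omega> + t * z \<omega>\<bar>) + (LINT \<omega>|M. \<bar>x \<omega> - t * z \<omega>\<bar>)"
proof -
  have [measurable]: "x \<in> borel_measurable M" "z \<in> borel_measurable M" "f \<in> borel_measurable M"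
    using x z f by auto
  have A: "A \<in> sets M" unfolding A_def by measurable
  have ind: "integrable M (\<lambda>\<omega>. \<bar>g \<omega>\<bar> * indicator A \<omega>)" if "integrable M g" for g :: "'a \<Rightarrow> real"
    using integrable_real_mult_indicator[OF A integrable_abs[OF that]] by (simp add: mult.commute)
  have zs: "integrable M (\<lambda>\<omega>. z \<omega> * sgn (f \<omega>))"
    by (rule Bochner_Integration.integrable_bound[OF z]) (auto simp: abs_mult sgn_if)
  have "(LINT \<omega>|M. \<bar>z \<omega>\<bar> - 2 * \<eta> - 2 * (\<bar>z \<omega>\<bar> * indicator A \<omega>)) \<le> (LINT \<omega>|M. z \<omega> * sgn (f \<omega>))"
  proof (rule integral_mono)
    fix \<omega> assume "\<omega> \<in> space M"
    then show "\<bar>z \<omega>\<bar> - 2 * \<eta> - 2 * (\<bar>z \<omega>\<bar> * indicator A \<omega>) \<le> z \<omega> * sgn (f \<omega>)"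
      using \<eta> by (auto simp: A_def indicator_def sgn_if abs_if split: if_splits)
  qed (use z zs ind in auto)
  then have z_on_A: "(LINT \<omega>|M. \<bar>z \<omega>\<bar>) - 2 * \<eta> * measure M (space M) \<le> 2 * (LINT \<omega>|M. \<bar>z \<omega>\<bar> * indicator A \<omega>)"
  proof -
    have "(LINT \<omega>|M. \<bar>z \<omega>\<bar> - 2 * \<eta> - 2 * (\<bar>z \<omega>\<bar> * indicator A \<omega>)) =
        (LINT \<omega>|M. \<bar>z \<omega>\<bar>) - measure M (space M) * (2 * \<eta>) - 2 * (LINT \<omega>|M. \<bar>z \<omega>\<bar> * indicator A \<omega>)"
      using z ind[OF z] by simp
    moreover have "measure M (space M) * (2 * \<eta>) = 2 * \<eta> * measure M (space M)"
      by (rule mult.commute)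
    ultimately show ?thesis
      using \<open>_ \<le> (LINT \<omega>|M. z \<omega> * sgn (f \<omega>))\<close> orth by linarith
  qed
  have "(LINT \<omega>|M. 2 * \<bar>x \<omega>\<bar> - 2 * (\<bar>x \<omega>\<bar> * indicator A \<omega>) + 2 * t * (\<bar>z \<omega>\<bar> * indicator A \<omega>))
      \<le> (LINT \<omega>|M. \<bar>x \<omega> + t * z \<omega>\<bar> + \<bar>x \<omega> - t * z \<omega>\<bar>)"
  proof (rule integral_mono)
    fix \<omega>
    have "2 * \<bar>x \<omega>\<bar> \<le> \<bar>x \<omega> + t * z \<omega>\<bar> + \<bar>x \<omega> - t * z \<omega>\<bar>" by linarith
    moreover have "2 * (t * \<bar>z \<omega>\<bar>) \<le> \<bar>x \<omega> + t * z \<omega>\<bar> + \<bar>x \<omega> - t * z \<omega>\<bar>"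
    proof -
      have "t * \<bar>z \<omega>\<bar> = \<bar>t * z \<omega>\<bar>" using t by (simp add: abs_mult)
      then show ?thesis by linarith
    qed
    ultimately show "2 * \<bar>x \<omega>\<bar> - 2 * (\<bar>x \<omega>\<bar> * indicator A \<omega>) + 2 * t * (\<bar>z \<omega>\<bar> * indicator A \<omega>)
        \<le> \<bar>x \<omega> + t * z \<omega>\<bar> + \<bar>x \<omega> - t * z \<omega>\<bar>"
      by (cases "\<omega> \<in> A") (simp_all add: mult.assoc)
  qed (use x z ind in auto)
  then have "2 * (LINT \<omega>|M. \<bar>x \<omega>\<bar>) - 2 * (LINT \<omega>|M. \<bar>x \<omega>\<bar> * indicator A \<omega>)
      + t * (2 * (LINT \<omega>|M. \<bar>z \<omega>\<bar> * indicator A \<omega>))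
      \<le> (LINT \<omega>|M. \<bar>x \<omega> + t * z \<omega>\<bar>) + (LINT \<omega>|M. \<bar>x \<omega> - t * z \<omega>\<bar>)"
    using x z ind[OF x] ind[OF z] by simp
  then show ?thesis using mult_left_mono[OF z_on_A t] by linarith
qed

lift_definition sgn_pairing :: "l0 \<Rightarrow> l0 \<Rightarrow> real" is
  "\<lambda>f g. LINT x|unit_interval. g x * sgn (f x)"
proof -
  fix f f' g g' :: "real \<Rightarrow> real"
  assume f: "f \<in> borel_measurable unit_interval \<and> f' \<in> borel_measurable unit_interval \<and>
      (AE x in unit_interval. f x = f' x)"
    and g: "g \<in> borel_measurable unit_interval \<and> g' \<in> borel_measurable unit_interval \<and>
      (AE x in unit_interval. g x = g' x)"
  have [measurable]: "f \<in> borel_measurable unit_interval" "f' \<in> borel_measurable unit_interval"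
      "g \<in> borel_measurable unit_interval" "g' \<in> borel_measurable unit_interval"
    using f g by auto
  show "(LINT x|unit_interval. g x * sgn (f x)) = (LINT x|unit_interval. g' x * sgn (f' x))"
    by (rule integral_cong_AE) (use f g in auto)
qed

lemma sgn_pairing_in_dual:
  assumes "X \<subseteq> L1"
  shows "sgn_pairing f \<in> dual_space X norm1"
proof -
  have int: "integrable unit_interval (\<lambda>x. g x * sgn (f x))"
    if "integrable unit_interval g" "f \<in> borel_measurable unit_interval" for f g :: "real \<Rightarrow> real"
  proof -
    have [measurable]: "g \<in> borel_measurable unit_interval" "f \<in> borel_measurable unit_interval"
      using that by auto
    show ?thesis by (rule Bochner_Integration.integrable_bound[OF that(1)]) (auto simp: abs_mult sgn_if)
  qed
  have add: "sgn_pairing f (g + h) = sgn_pairing f g + sgn_pairing f h" if "g \<in> L1" "h \<in> L1" for g h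
    using that unfolding L1_def mem_Collect_eq
  proof (transfer, goal_cases)
    case (1 g h f)
    then have "integrable unit_interval (\<lambda>x. g x * sgn (f x))" "integrable unit_interval (\<lambda>x. h x * sgn (f x))"
      by (auto intro!: int)
    then show ?case by (simp add: distrib_right)
  qed
  have scale: "sgn_pairing f (c *\<^sub>R g) = c * sgn_pairing f g" for g c
    by transfer (simp add: mult.assoc)
  have bound: "\<bar>sgn_pairing f g\<bar> \<le> 1 * norm1 g" if "g \<in> L1" for g
    using that unfolding L1_def mem_Collect_eq
  proof (transfer, goal_cases)
    case (1 g f)
    have "\<bar>LINT x|unit_interval. g x * sgn (f x)\<bar> \<le> (LINT x|unit_interval. \<bar>g x * sgn (f x)\<bar>)"
      by (rule integral_abs_bound)
    also have "\<dots> \<le> (LINT x|unit_interval. \<bar>g x\<bar>)"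
      using 1 by (intro integral_mono integrable_abs int) (auto simp: abs_mult sgn_if)
    finally show ?case by simp
  qed
  show ?thesis
    using assms add scale bound by (auto simp: dual_space_def is_linear_on_def subset_iff intro!: exI[of _ 1])
qed

text \<open>The bound \<open>d\<close> on the measure of the exceptional set depends on \<open>x\<close> but not on \<open>f\<close> or \<open>z\<close>: it has
  to be known before the finite cover whose centres serve as \<open>f\<close> is chosen.\<close>

lemma L1_midpoint_estimate:
  assumes x: "x \<in> L1" and \<epsilon>: "0 < \<epsilon>" and t: "0 \<le> t" and \<eta>: "0 \<le> \<eta>"
  shows "\<exists>d>0. \<forall>z\<in>L1. \<forall>f. deviation \<eta> z f < d \<longrightarrow> sgn_pairing f z = 0 \<longrightarrow>
    2 * norm1 x - 2 * \<epsilon> + t * (norm1 z - 2 * \<eta>) \<le> norm1 (x + t *\<^sub>R z) + norm1 (x - t *\<^sub>R z)"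
proof -
  interpret finite_measure unit_interval by (rule finite_measure_unit_interval)
  have "\<exists>d>0. \<forall>z. integrable_l0 z \<longrightarrow> (\<forall>f. deviation \<eta> z f < d \<longrightarrow> sgn_pairing f z = 0 \<longrightarrow>
    2 * norm1 x - 2 * \<epsilon> + t * (norm1 z - 2 * \<eta>) \<le> norm1 (x + t *\<^sub>R z) + norm1 (x - t *\<^sub>R z))"
    using x unfolding L1_def mem_Collect_eq
  proof (transfer fixing: \<epsilon> t \<eta>, goal_cases)
    case (1 x)
    obtain d where d: "0 < d" "\<And>A. A \<in> sets unit_interval \<Longrightarrow> measure unit_interval A < d \<Longrightarrow>
        (LINT \<omega>|unit_interval. \<bar>x \<omega>\<bar> * indicator A \<omega>) \<le> \<epsilon>"
      using integral_small_on_small_sets[of x \<epsilon>] 1 \<epsilon> by blast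
    have "2 * (LINT \<omega>|unit_interval. \<bar>x \<omega>\<bar>) - 2 * \<epsilon> + t * ((LINT \<omega>|unit_interval. \<bar>z \<omega>\<bar>) - 2 * \<eta>)
        \<le> (LINT \<omega>|unit_interval. \<bar>x \<omega> + t * z \<omega>\<bar>) + (LINT \<omega>|unit_interval. \<bar>x \<omega> - t * z \<omega>\<bar>)"
      if z: "integrable unit_interval z" and f: "f \<in> borel_measurable unit_interval"
        and dev: "measure unit_interval {\<omega> \<in> {0..1}. \<eta> \<le> \<bar>z \<omega> - f \<omega>\<bar>} < d"
        and orth: "(LINT \<omega>|unit_interval. z \<omega> * sgn (f \<omega>)) = 0" for z f
    proof -
      let ?A = "{\<omega> \<in> space unit_interval. \<eta> \<le> \<bar>z \<omega> - f \<omega>\<bar>}"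
      have "?A \<in> sets unit_interval" using z f by (intro deviation_set) auto
      then have "(LINT \<omega>|unit_interval. \<bar>x \<omega>\<bar> * indicator ?A \<omega>) \<le> \<epsilon>" using dev by (intro d(2)) simp_all
      moreover have "measure unit_interval (space unit_interval) = 1"
        by (simp add: measure_restrict_space)
      ultimately show ?thesis
        using midpoint_estimate[of x z f t \<eta>] 1 z f orth t \<eta> by simp
    qed
    then show ?case using d(1) by auto
  qed
  then show ?thesis by (auto simp: L1_def)
qed

lemma relatively_compact_finite_net:
  assumes S: "relatively_compact_in measure_topology S" and \<eta>: "0 < \<eta>" and d: "0 < d"
  obtains F where "finite F" "\<And>z. z \<in> S \<Longrightarrow> \<exists>f\<in>F. deviation \<eta> z f < d"
proof -
  interpret Metric_space UNIV dist_l0 by (rule Metric_space_dist_l0)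
  define r where "r = min 1 \<eta> * d"
  have r: "0 < r" using \<eta> d by (simp add: r_def)
  let ?K = "measure_topology closure_of S"
  have "compactin mtopology ?K"
    using S by (simp add: relatively_compact_in_def measure_topology_eq_mtopology)
  moreover have "?K \<subseteq> \<Union>(range (\<lambda>f. mball f r))" using r by auto
  ultimately obtain \<F> where \<F>: "finite \<F>" "\<F> \<subseteq> range (\<lambda>f. mball f r)" "?K \<subseteq> \<Union>\<F>"
    unfolding compactin_def by (metis (no_types, lifting) imageE openin_mball)
  obtain F where F: "finite F" "\<F> = (\<lambda>f. mball f r) ` F"
    using finite_subset_image[OF \<F>(1,2)] by blast
  show ?thesis
  proof (rule that[OF F(1)])
    fix z assume "z \<in> S"
    then have "z \<in> ?K" using closure_of_subset[of S measure_topology] by auto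
    then obtain f where f: "f \<in> F" "dist_l0 f z < r" using \<F>(3) F(2) by auto
    have "min 1 \<eta> * deviation \<eta> z f \<le> dist_l0 z f" by (rule deviation_le_dist_l0[OF \<eta>])
    also have "\<dots> < min 1 \<eta> * d" using f(2) by (simp add: r_def commute)
    finally have "deviation \<eta> z f < d" using \<eta> by (simp add: mult_less_cancel_left)
    then show "\<exists>f\<in>F. deviation \<eta> z f < d" using f(1) by blast
  qed
qed

text \<open>The modulus at \<open>t\<close> is at least \<open>t / 4\<close>. The subspace for \<open>x\<close> is the joint kernel of the pairings with
  the signs of the centres of a finite cover, whose fineness is dictated by \<open>x\<close>.\<close>

theorem relatively_compact_ball_imp_AMUC:
  assumes X: "subspace X" "X \<subseteq> L1"
    and rc: "relatively_compact_in measure_topology (unit_ball X norm1)"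
  shows "asymp_midpoint_uniformly_convex X norm1"
  unfolding asymp_midpoint_uniformly_convex_def
proof (intro allI impI)
  interpret normed_subspace X norm1
    using X is_norm_on_L1 by unfold_locales (auto simp: is_norm_on_def subset_iff)
  fix t :: real assume t: "0 < t"
  have "ereal (t / 4) \<le> amuc_modulus X norm1 t"
    unfolding amuc_modulus_def
  proof (rule INF_greatest)
    fix x assume x: "x \<in> unit_sphere X norm1"
    then have "x \<in> L1" "norm1 x = 1" using X by (auto simp: unit_sphere_def)
    then obtain d where d: "0 < d" "\<And>z f. z \<in> L1 \<Longrightarrow> deviation (1/8) z f < d \<Longrightarrow> sgn_pairing f z = 0 \<Longrightarrow>
        2 * norm1 x - 2 * (t / 8) + t * (norm1 z - 2 * (1/8)) \<le> norm1 (x + t *\<^sub>R z) + norm1 (x - t *\<^sub>R z)"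
      using L1_midpoint_estimate[of x "t / 8" t "1/8"] t by auto
    obtain F where F: "finite F" "\<And>z. z \<in> unit_ball X norm1 \<Longrightarrow> \<exists>f\<in>F. deviation (1/8) z f < d"
      using relatively_compact_finite_net[OF rc _ d(1), of "1/8"] by auto
    define Z where "Z = {z \<in> X. \<forall>\<phi>\<in>sgn_pairing ` F. \<phi> z = 0}"
    have "Z \<in> cof X norm1"
      unfolding Z_def using F(1) sgn_pairing_in_dual[OF X(2)] by (intro kernel_in_cof) auto
    moreover have "ereal (t / 4) \<le> (INF z\<in>unit_sphere Z norm1.
        ereal (max (norm1 (x + t *\<^sub>R z)) (norm1 (x - t *\<^sub>R z)) - 1))"
    proof (rule INF_greatest)
      fix z assume "z \<in> unit_sphere Z norm1"
      then have z: "z \<in> X" "norm1 z = 1" "\<forall>f\<in>F. sgn_pairing f z = 0"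
        by (auto simp: unit_sphere_def Z_def)
      then obtain f where f: "f \<in> F" "deviation (1/8) z f < d" using F(2)[of z] unfolding unit_ball_def by fastforce
      have "2 - t / 4 + t * (3 / 4) \<le> norm1 (x + t *\<^sub>R z) + norm1 (x - t *\<^sub>R z)"
        using d(2)[of z f] z f X \<open>norm1 x = 1\<close> by auto
      then show "ereal (t / 4) \<le> ereal (max (norm1 (x + t *\<^sub>R z)) (norm1 (x - t *\<^sub>R z)) - 1)"
        by simp
    qed
    ultimately show "ereal (t / 4) \<le> (SUP Z\<in>cof X norm1. INF z\<in>unit_sphere Z norm1.
        ereal (max (norm1 (x + t *\<^sub>R z)) (norm1 (x - t *\<^sub>R z)) - 1))"
      by (rule SUP_upper2)
  qed
  moreover have "0 < ereal (t / 4)" using t by simp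
  ultimately show "0 < amuc_modulus X norm1 t" by (rule less_le_trans[rotated])
qed

theorem corollary1:
  fixes X :: "l0 set"
  assumes "subspace X" and "X \<subseteq> L1" and "X \<noteq> {0}"
    and "closedin (norm_topology L1 norm1) X"
    and "daugavet_property X norm1"
    and "relatively_compact_in measure_topology (unit_ball X norm1)"
  shows "asymp_midpoint_uniformly_convex X norm1 \<and>
         \<not> point_of_continuity_property X norm1 \<and>
         \<not> (\<exists>N. equivalent_norm X norm1 N \<and> asymp_uniformly_convex X N)"
proof -
  interpret normed_subspace X norm1
    using assms(1,2) is_norm_on_L1 by unfold_locales (auto simp: is_norm_on_def subset_iff)
  show ?thesis
    using relatively_compact_ball_imp_AMUC[OF assms(1,2,6)] daugavet_imp_not_PCP[OF assms(5,3)]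
      daugavet_imp_not_AUC_renorming[OF assms(5,3)] by blast
qed

end
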